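(* (1) For $b\in\mathcal A_\infty$, the sequence $\left(\frac53\right)^m\mathcal E_m[\rho_m(b)]$, $m\ge0$, is nondecreasing. Hence its limit $$\mathcal E_\infty[b]=\lim_{m\to\infty}\left(\tfrac53\right)^m\mathcal E_m[\rho_m(b)]$$ exists in $[0,+\infty]$. (2) $\mathcal E_\infty$ is a densely defined quadratic form on $\mathcal A_\infty$, closed for the uniform topology; that is, its domain $$\mathcal B=\{b\in\mathcal A_\infty:\ \mathcal E_\infty[b]<+\infty\}$$ is dense in $\mathcal A_\infty$ and is a complete space for the norm $\left(\|b\|_{\mathcal A_\infty}^2+\mathcal E_\infty[b]\right)^{1/2}$.
   Context: Indices $j\in\{1,2,3\}$ are taken mod $3$. $M_3(\mathbb C)$ has matrix units $e_{ij}$, and $\mathbb C^3$ is identified with its diagonal subalgebra. $\mathrm{UHF}(3^\infty)$ is the $C^*$-inductive limit of $M_3(\mathbb C)^{\otimes n}$ under $x\mapsto x\otimes I_3$; each $M_3(\mathbb C)^{\otimes n}$ is regarded as a unital subalgebra of it. For $n\ge0$ put $\alpha^n_j=e_{jj}\otimes e_{22}^{\otimes n}\in M_3(\mathbb C)^{\otimes(n+1)}$, and for $k\ge1$ put $\beta^k_j=(e_{jj}\otimes e_{11}+e_{j+2,j+2}\otimes e_{33})\otimes e_{22}^{\otimes(k-1)}\in M_3(\mathbb C)^{\otimes(k+1)}$. The finite-dimensional $*$-algebra $\mathcal A_n\subset M_3(\mathbb C)^{\otimes n}\otimes\mathbb C^3\subset M_3(\mathbb C)^{\otimes(n+1)}$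 is the linear span of the $\alpha^n_j$ and of the $x\otimes\beta^k_j$ with $j=1,2,3$, $k=1,\dots,n$, $x\in M_3(\mathbb C)^{\otimes(n-k)}$. $\mathcal A_\infty$ is the $C^*$-subalgebra of $\mathrm{UHF}(3^\infty)$ of all norm limits $\lim_n a_n$ with $a_n\in\mathcal A_n$. The slice map $\rho_m:\mathrm{UHF}(3^\infty)\to M_3(\mathbb C)^{\otimes(m+1)}$, identity on the first $m+1$ tensor factors and applying the state $x\mapsto x_{22}$ to each of the others, restricts to a $*$-homomorphism $\rho_m:\mathcal A_\infty\to\mathcal A_m$. An element $b\in M_3(\mathbb C)^{\otimes n}\otimes\mathbb C^3$ is written $b=\sum_i b(v_i)\otimes e_{ii}$ with $b(v_i)\in M_3(\mathbb C)^{\otimes n}$. For $b\in\mathcal A_n$, $\mathcal E_n[b]=\sum_{i\ne j}\mathrm{Tr}\big(|b(v_i)-b(v_j)|^2\big)$, where $\mathrm{Tr}$ is the unnormalized trace on $M_3(\mathbb C)^{\otimes n}$ and $i,j$ range over $\{1,2,3\}$. *)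

theory Defs
  imports "HOL-Analysis.Analysis" "HOL-Library.Function_Algebras"
begin

section \<open>Matrices over words\<close>

text \<open>
  The matrix algebra $Mat_3(\mathbb C)^{\otimes n}$ consists of matrices whose rows and columns are
  indexed by the words of length $n$ over the index set $\{1,2,3\}$.  The latter is the type
  \<^typ>\<open>3\<close> of integers modulo 3, so that index arithmetic is automatically modulo 3 and \<open>3 = 0\<close>.
  All levels share one type; a matrix of level $n$ vanishes outside the words of length $n$.

  Pitfall: addition and subtraction of matrices are the pointwise operations on functions, but
  \<open>*\<close> and \<open>1\<close> on this function type are pointwise too; the matrix product is \<open>mmult\<close> and the
  identity matrix \<open>ident\<close>.
\<close>

type_synonym word3 = "3 list"
type_synonym mat = "word3 \<Rightarrow> word3 \<Rightarrow> complex"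

definition words :: "nat \<Rightarrow> word3 set" where
  "words n = {u. length u = n}"

definition Mat :: "nat \<Rightarrow> mat set" where
  "Mat n = {x. \<forall>u v. x u v \<noteq> 0 \<longrightarrow> u \<in> words n \<and> v \<in> words n}"

definition mscale :: "complex \<Rightarrow> mat \<Rightarrow> mat" where
  "mscale c x = (\<lambda>u v. c * x u v)"

definition mmult :: "nat \<Rightarrow> mat \<Rightarrow> mat \<Rightarrow> mat" where
  "mmult n x y = (\<lambda>u v. \<Sum>w\<in>words n. x u w * y w v)"

definition adj :: "mat \<Rightarrow> mat" where
  "adj x = (\<lambda>u v. cnj (x v u))"

definition ident :: "nat \<Rightarrow> mat" where
  "ident n = (\<lambda>u v. if u \<in> words n \<and> u = v then 1 else 0)"

definition tr :: "nat \<Rightarrow> mat \<Rightarrow> complex" where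
  "tr n x = (\<Sum>u\<in>words n. x u u)"

text \<open>\<open>tensor m x y\<close> is $x\otimes y$ for $x$ of level $m$ and $y$ of any level.\<close>

definition tensor :: "nat \<Rightarrow> mat \<Rightarrow> mat \<Rightarrow> mat" where
  "tensor m x y = (\<lambda>u v. x (take m u) (take m v) * y (drop m u) (drop m v))"

text \<open>The embedding $x\mapsto x\otimes I_3^{\otimes(n-m)}$ of level $m$ into level $n\ge m$.\<close>

definition emb :: "nat \<Rightarrow> nat \<Rightarrow> mat \<Rightarrow> mat" where
  "emb m n x = tensor m x (ident (n - m))"

text \<open>The operator norm of a matrix of level $n$ on the Hilbert space $\ell^2$ of words of
  length $n$, that is, its C*-norm.\<close>

definition l2 :: "nat \<Rightarrow> (word3 \<Rightarrow> complex) \<Rightarrow> real" where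
  "l2 n \<xi> = L2_set (\<lambda>u. cmod (\<xi> u)) (words n)"

definition mapply :: "nat \<Rightarrow> mat \<Rightarrow> (word3 \<Rightarrow> complex) \<Rightarrow> (word3 \<Rightarrow> complex)" where
  "mapply n x \<xi> = (\<lambda>u. \<Sum>v\<in>words n. x u v * \<xi> v)"

definition opnorm :: "nat \<Rightarrow> mat \<Rightarrow> real" where
  "opnorm n x = (SUP \<xi>\<in>{\<xi>. l2 n \<xi> \<le> 1}. l2 n (mapply n x \<xi>))"

subsection \<open>Basic properties\<close>

lemma finite_words [simp, intro]: "finite (words n)"
  using finite_lists_length_eq[of "UNIV :: 3 set" n] by (simp add: words_def)

lemma words_nonempty [simp]: "words n \<noteq> {}"
  by (auto simp: words_def intro: exI[of _ "replicate n undefined"])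

global_interpretation mat: vector_space mscale
  by standard (auto simp: mscale_def fun_eq_iff algebra_simps)

lemma Mat_iff: "x \<in> Mat n \<longleftrightarrow> (\<forall>u v. u \<notin> words n \<or> v \<notin> words n \<longrightarrow> x u v = 0)"
  unfolding Mat_def by blast

lemma Mat_D: "x \<in> Mat n \<Longrightarrow> u \<notin> words n \<or> v \<notin> words n \<Longrightarrow> x u v = 0"
  unfolding Mat_iff by blast

lemma Mat_add: "x \<in> Mat n \<Longrightarrow> y \<in> Mat n \<Longrightarrow> x + y \<in> Mat n"
  by (simp add: Mat_iff)

lemma Mat_diff: "x \<in> Mat n \<Longrightarrow> y \<in> Mat n \<Longrightarrow> x - y \<in> Mat n"
  by (simp add: Mat_iff)

lemma Mat_uminus: "x \<in> Mat n \<Longrightarrow> - x \<in> Mat n"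
  by (simp add: Mat_iff)

lemma Mat_scale: "x \<in> Mat n \<Longrightarrow> mscale c x \<in> Mat n"
  by (simp add: Mat_iff mscale_def)

lemma Mat_zero: "0 \<in> Mat n"
  by (simp add: Mat_iff)

lemma Mat_ident: "ident n \<in> Mat n"
  by (auto simp: Mat_iff ident_def)

lemma Mat_adj: "x \<in> Mat n \<Longrightarrow> adj x \<in> Mat n"
  by (auto simp: Mat_iff adj_def)

lemma Mat_mmult: "x \<in> Mat n \<Longrightarrow> y \<in> Mat n \<Longrightarrow> mmult n x y \<in> Mat n"
  by (auto simp: Mat_iff mmult_def intro!: sum.neutral)

lemma Mat_tensor:
  assumes "x \<in> Mat m" "y \<in> Mat k"
  shows "tensor m x y \<in> Mat (m + k)"
proof -
  have "u \<in> words (m + k) \<longleftrightarrow> take m u \<in> words m \<and> drop m u \<in> words k" for u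
    by (auto simp: words_def)
  then show ?thesis
    using assms unfolding Mat_iff tensor_def mult_eq_0_iff by blast
qed

lemma Mat_emb: "x \<in> Mat m \<Longrightarrow> m \<le> n \<Longrightarrow> emb m n x \<in> Mat n"
  unfolding emb_def using Mat_tensor[OF _ Mat_ident, of x m "n - m"] by simp

lemma l2_nonneg [simp]: "0 \<le> l2 n \<xi>"
  by (simp add: l2_def)

lemma l2_sq: "(l2 n \<xi>)\<^sup>2 = (\<Sum>u\<in>words n. (cmod (\<xi> u))\<^sup>2)"
  by (simp add: l2_def L2_set_def sum_nonneg)

lemma l2_triangle: "l2 n (\<lambda>u. \<xi> u + \<eta> u) \<le> l2 n \<xi> + l2 n \<eta>"
proof -
  have "l2 n (\<lambda>u. \<xi> u + \<eta> u) \<le> L2_set (\<lambda>u. cmod (\<xi> u) + cmod (\<eta> u)) (words n)"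
    unfolding l2_def by (intro L2_set_mono norm_triangle_ineq) auto
  also have "\<dots> \<le> l2 n \<xi> + l2 n \<eta>"
    unfolding l2_def by (rule L2_set_triangle_ineq)
  finally show ?thesis .
qed

lemma l2_scale: "l2 n (\<lambda>u. c * \<xi> u) = cmod c * l2 n \<xi>"
  unfolding l2_def by (simp add: norm_mult L2_set_right_distrib)

lemma l2_zero [simp]: "l2 n (\<lambda>u. 0) = 0"
  by (simp add: l2_def L2_set_0')

lemma l2_entry: "u \<in> words n \<Longrightarrow> cmod (\<xi> u) \<le> l2 n \<xi>"
  unfolding l2_def by (rule member_le_L2_set) auto

lemma mapply_scale: "mapply n x (\<lambda>u. c * \<xi> u) = (\<lambda>u. c * mapply n x \<xi> u)"
  by (simp add: mapply_def sum_distrib_left mult_ac)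

lemma l2_mapply_crude:
  assumes "l2 n \<xi> \<le> 1"
  shows "l2 n (mapply n x \<xi>) \<le> (\<Sum>u\<in>words n. \<Sum>v\<in>words n. cmod (x u v))"
proof -
  have "l2 n (mapply n x \<xi>) \<le> (\<Sum>u\<in>words n. cmod (mapply n x \<xi> u))"
    unfolding l2_def by (rule L2_set_le_sum) auto
  also have "\<dots> \<le> (\<Sum>u\<in>words n. \<Sum>v\<in>words n. cmod (x u v))"
  proof (rule sum_mono)
    fix u
    have "cmod (mapply n x \<xi> u) \<le> (\<Sum>v\<in>words n. cmod (x u v * \<xi> v))"
      unfolding mapply_def by (rule norm_sum)
    also have "\<dots> \<le> (\<Sum>v\<in>words n. cmod (x u v))"
    proof (rule sum_mono)
      fix v assume "v \<in> words n"
      then have "cmod (\<xi> v) \<le> 1"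
        using l2_entry[of v n \<xi>] assms by simp
      then show "cmod (x u v * \<xi> v) \<le> cmod (x u v)"
        by (simp add: norm_mult mult_left_le)
    qed
    finally show "cmod (mapply n x \<xi> u) \<le> (\<Sum>v\<in>words n. cmod (x u v))" .
  qed
  finally show ?thesis .
qed

lemma opnorm_bdd: "bdd_above ((\<lambda>\<xi>. l2 n (mapply n x \<xi>)) ` {\<xi>. l2 n \<xi> \<le> 1})"
  using l2_mapply_crude by (force simp: bdd_above_def)

lemma opnorm_unit: "l2 n \<xi> \<le> 1 \<Longrightarrow> l2 n (mapply n x \<xi>) \<le> opnorm n x"
  unfolding opnorm_def by (rule cSUP_upper[OF _ opnorm_bdd]) auto

lemma opnorm_nonneg [simp]: "0 \<le> opnorm n x"
  by (rule order_trans[OF l2_nonneg opnorm_unit[of n "\<lambda>u. 0"]]) simp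

lemma opnorm_bound: "l2 n (mapply n x \<xi>) \<le> opnorm n x * l2 n \<xi>"
proof (cases "l2 n \<xi> = 0")
  case True
  then have "\<xi> u = 0" if "u \<in> words n" for u
    using l2_entry[OF that, of \<xi>] by simp
  then have "mapply n x \<xi> = (\<lambda>u. 0)"
    by (simp add: mapply_def)
  then show ?thesis
    by (simp add: True)
next
  case False
  then have pos: "l2 n \<xi> > 0"
    by (simp add: less_le)
  define c where "c = complex_of_real (1 / l2 n \<xi>)"
  have c: "cmod c = 1 / l2 n \<xi>"
    using pos by (simp add: c_def norm_divide)
  have "l2 n (\<lambda>u. c * \<xi> u) \<le> 1"
    using pos by (simp add: l2_scale c)
  from opnorm_unit[OF this, of x] show ?thesis
    using pos by (simp add: mapply_scale l2_scale c field_simps)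
qed

lemma opnorm_leI:
  assumes "0 \<le> c" "\<And>\<xi>. l2 n (mapply n x \<xi>) \<le> c * l2 n \<xi>"
  shows "opnorm n x \<le> c"
  unfolding opnorm_def
proof (rule cSUP_least)
  show "{\<xi>. l2 n \<xi> \<le> 1} \<noteq> {}"
    by (auto intro: exI[of _ "\<lambda>u. 0"])
  fix \<xi> assume "\<xi> \<in> {\<xi>. l2 n \<xi> \<le> 1}"
  then have "c * l2 n \<xi> \<le> c"
    using assms(1) by (simp add: mult_left_le)
  then show "l2 n (mapply n x \<xi>) \<le> c"
    using assms(2) order_trans by blast
qed

lemma opnorm_triangle: "opnorm n (x + y) \<le> opnorm n x + opnorm n y"
proof (rule opnorm_leI)
  fix \<xi>
  have "mapply n (x + y) \<xi> = (\<lambda>u. mapply n x \<xi> u + mapply n y \<xi> u)"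
    by (simp add: mapply_def algebra_simps sum.distrib)
  then have "l2 n (mapply n (x + y) \<xi>) \<le> l2 n (mapply n x \<xi>) + l2 n (mapply n y \<xi>)"
    by (simp add: l2_triangle)
  also have "\<dots> \<le> (opnorm n x + opnorm n y) * l2 n \<xi>"
    using opnorm_bound[of n x \<xi>] opnorm_bound[of n y \<xi>] by (simp add: algebra_simps)
  finally show "l2 n (mapply n (x + y) \<xi>) \<le> (opnorm n x + opnorm n y) * l2 n \<xi>" .
qed simp

lemma opnorm_scale_le: "opnorm n (mscale c x) \<le> cmod c * opnorm n x"
proof (rule opnorm_leI)
  fix \<xi>
  have "mapply n (mscale c x) \<xi> = (\<lambda>u. c * mapply n x \<xi> u)"
    by (simp add: mapply_def mscale_def sum_distrib_left mult_ac)
  then show "l2 n (mapply n (mscale c x) \<xi>) \<le> cmod c * opnorm n x * l2 n \<xi>"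
    using opnorm_bound[of n x \<xi>] by (simp add: l2_scale mult_left_mono mult.assoc)
qed simp

lemma opnorm_zero [simp]: "opnorm n 0 = 0"
proof -
  have "opnorm n 0 \<le> 0"
  proof (rule opnorm_leI)
    fix \<xi>
    have "mapply n 0 \<xi> = (\<lambda>u. 0)"
      by (simp add: mapply_def)
    then show "l2 n (mapply n 0 \<xi>) \<le> 0 * l2 n \<xi>"
      by (simp only: l2_zero)
  qed simp
  then show ?thesis
    using opnorm_nonneg[of n 0] by linarith
qed

lemma opnorm_scale: "opnorm n (mscale c x) = cmod c * opnorm n x"
proof (cases "c = 0")
  case True
  then show ?thesis by (simp add: mat.scale_zero_left)
next
  case False
  have "opnorm n x = opnorm n (mscale (inverse c) (mscale c x))"
    using False by (simp)
  also have "\<dots> \<le> inverse (cmod c) * opnorm n (mscale c x)"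
    using opnorm_scale_le[of n "inverse c" "mscale c x"] by (simp add: norm_inverse)
  finally have "cmod c * opnorm n x \<le> opnorm n (mscale c x)"
    using False by (simp add: field_simps)
  then show ?thesis
    using opnorm_scale_le[of n c x] by simp
qed

lemma opnorm_uminus [simp]: "opnorm n (- x) = opnorm n x"
proof -
  have "- x = mscale (-1) x"
    by (simp add: mscale_def fun_eq_iff)
  then show ?thesis
    using opnorm_scale[of n "-1" x] by simp
qed

lemma opnorm_minus_commute: "opnorm n (x - y) = opnorm n (y - x)"
  by (metis minus_diff_eq opnorm_uminus)

lemma opnorm_diff_triangle: "opnorm n (x - z) \<le> opnorm n (x - y) + opnorm n (y - z)"
  using opnorm_triangle[of n "x - y" "y - z"] by simp

lemma opnorm_triangle_abs: "\<bar>opnorm n x - opnorm n y\<bar> \<le> opnorm n (x - y)"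
  using opnorm_triangle[of n "x - y" y] opnorm_triangle[of n "y - x" x]
  by (auto simp: opnorm_minus_commute[of n y x])

lemma mapply_mmult: "mapply n (mmult n x y) \<xi> = mapply n x (mapply n y \<xi>)"
  unfolding mapply_def mmult_def
  by (auto simp: sum_distrib_left sum_distrib_right mult_ac fun_eq_iff intro: sum.swap)

lemma opnorm_mmult: "opnorm n (mmult n x y) \<le> opnorm n x * opnorm n y"
proof (rule opnorm_leI)
  fix \<xi>
  have "l2 n (mapply n x (mapply n y \<xi>)) \<le> opnorm n x * l2 n (mapply n y \<xi>)"
    by (rule opnorm_bound)
  also have "\<dots> \<le> opnorm n x * (opnorm n y * l2 n \<xi>)"
    by (intro mult_left_mono opnorm_bound) simp
  finally show "l2 n (mapply n (mmult n x y) \<xi>) \<le> opnorm n x * opnorm n y * l2 n \<xi>"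
    by (simp add: mapply_mmult mult.assoc)
qed simp

lemma mapply_delta: "v \<in> words n \<Longrightarrow> mapply n x (\<lambda>w. if w = v then 1 else 0) u = x u v"
  by (simp add: mapply_def if_distrib if_distribR sum.delta cong: if_cong)

lemma l2_delta: "v \<in> words n \<Longrightarrow> l2 n (\<lambda>w. if w = v then 1 else 0) = 1"
proof -
  assume v: "v \<in> words n"
  have "(\<Sum>u\<in>words n. (cmod (if u = v then 1 else 0))\<^sup>2) = (\<Sum>u\<in>words n. if u = v then 1 else 0)"
    by (rule sum.cong) auto
  then show ?thesis
    using v by (simp add: l2_def L2_set_def)
qed

lemma opnorm_entry: "u \<in> words n \<Longrightarrow> v \<in> words n \<Longrightarrow> cmod (x u v) \<le> opnorm n x"
  using opnorm_bound[of n x "\<lambda>w. if w = v then 1 else 0"]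
    l2_entry[of u n "mapply n x (\<lambda>w. if w = v then 1 else 0)"]
  by (simp add: mapply_delta l2_delta)

lemma opnorm_ident [simp]: "opnorm n (ident n) = 1"
proof (rule antisym)
  have app: "mapply n (ident n) \<xi> u = \<xi> u" if "u \<in> words n" for u \<xi>
  proof -
    have "mapply n (ident n) \<xi> u = (\<Sum>v\<in>words n. if v = u then \<xi> v else 0)"
      unfolding mapply_def ident_def using that by (intro sum.cong) auto
    then show ?thesis using that by simp
  qed
  have "l2 n (mapply n (ident n) \<xi>) = l2 n \<xi>" for \<xi>
    unfolding l2_def by (rule L2_set_cong) (auto simp: app)
  then show "opnorm n (ident n) \<le> 1"
    by (intro opnorm_leI) auto
  obtain u where u: "u \<in> words n"
    using words_nonempty by blast
  then show "1 \<le> opnorm n (ident n)"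
    using opnorm_entry[OF u u, of "ident n"] by (simp add: ident_def)
qed

lemma adj_adj [simp]: "adj (adj x) = x"
  by (simp add: adj_def)

lemma inner_le: "cmod (\<Sum>u\<in>words n. cnj (\<xi> u) * \<eta> u) \<le> l2 n \<xi> * l2 n \<eta>"
proof -
  have "cmod (\<Sum>u\<in>words n. cnj (\<xi> u) * \<eta> u) \<le> (\<Sum>u\<in>words n. \<bar>cmod (\<xi> u)\<bar> * \<bar>cmod (\<eta> u)\<bar>)"
    by (rule order_trans[OF norm_sum]) (simp add: norm_mult)
  also have "\<dots> \<le> l2 n \<xi> * l2 n \<eta>"
    unfolding l2_def by (rule L2_set_mult_ineq)
  finally show ?thesis .
qed

lemma inner_adj:
  "(\<Sum>u\<in>words n. cnj (mapply n x \<xi> u) * \<eta> u) = (\<Sum>u\<in>words n. cnj (\<xi> u) * mapply n (adj x) \<eta> u)"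
proof -
  have "(\<Sum>u\<in>words n. cnj (mapply n x \<xi> u) * \<eta> u)
      = (\<Sum>u\<in>words n. \<Sum>v\<in>words n. cnj (x u v) * cnj (\<xi> v) * \<eta> u)"
    by (simp add: mapply_def sum_distrib_right)
  also have "\<dots> = (\<Sum>v\<in>words n. \<Sum>u\<in>words n. cnj (x u v) * cnj (\<xi> v) * \<eta> u)"
    by (rule sum.swap)
  also have "\<dots> = (\<Sum>u\<in>words n. cnj (\<xi> u) * mapply n (adj x) \<eta> u)"
    by (simp add: mapply_def adj_def sum_distrib_left mult_ac)
  finally show ?thesis .
qed

lemma l2_mapply_sq_le: "(l2 n (mapply n x \<xi>))\<^sup>2 \<le> l2 n \<xi> * l2 n (mapply n (mmult n (adj x) x) \<xi>)"
proof -
  have "complex_of_real ((l2 n (mapply n x \<xi>))\<^sup>2)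
      = (\<Sum>u\<in>words n. cnj (mapply n x \<xi> u) * mapply n x \<xi> u)"
    by (simp add: l2_sq complex_norm_square mult.commute del: of_real_power flip: of_real_power)
  also have "\<dots> = (\<Sum>u\<in>words n. cnj (\<xi> u) * mapply n (mmult n (adj x) x) \<xi> u)"
    by (simp add: inner_adj mapply_mmult)
  finally have "cmod (complex_of_real ((l2 n (mapply n x \<xi>))\<^sup>2))
      \<le> l2 n \<xi> * l2 n (mapply n (mmult n (adj x) x) \<xi>)"
    using inner_le by metis
  then show ?thesis
    by (simp add: norm_power)
qed

lemma opnorm_sq_le: "(opnorm n x)\<^sup>2 \<le> opnorm n (mmult n (adj x) x)"
proof -
  let ?c = "sqrt (opnorm n (mmult n (adj x) x))"
  have "opnorm n x \<le> ?c"
  proof (rule opnorm_leI)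
    fix \<xi>
    have "(l2 n (mapply n x \<xi>))\<^sup>2 \<le> l2 n \<xi> * (opnorm n (mmult n (adj x) x) * l2 n \<xi>)"
      by (rule order_trans[OF l2_mapply_sq_le]) (intro mult_left_mono opnorm_bound l2_nonneg)
    also have "\<dots> = (?c * l2 n \<xi>)\<^sup>2"
      by (simp add: power_mult_distrib power2_eq_square)
    finally show "l2 n (mapply n x \<xi>) \<le> ?c * l2 n \<xi>"
      by (rule power2_le_imp_le) simp
  qed simp
  then have "(opnorm n x)\<^sup>2 \<le> ?c\<^sup>2"
    by (rule power_mono) simp
  then show ?thesis by simp
qed

lemma opnorm_adj [simp]: "opnorm n (adj x) = opnorm n x"
proof -
  have *: "opnorm n y \<le> opnorm n (adj y)" for y
  proof (cases "opnorm n y = 0")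
    case False
    then have "0 < opnorm n y" by (simp add: less_le)
    moreover have "opnorm n y * opnorm n y \<le> opnorm n (adj y) * opnorm n y"
      using opnorm_sq_le[of n y] opnorm_mmult[of n "adj y" y] by (simp add: power2_eq_square)
    ultimately show ?thesis by simp
  qed simp
  show ?thesis
    using *[of x] *[of "adj x"] by simp
qed

lemma opnorm_cstar: "opnorm n (mmult n (adj x) x) = (opnorm n x)\<^sup>2"
  using opnorm_sq_le[of n x] opnorm_mmult[of n "adj x" x] by (simp add: power2_eq_square)

lemma sum_words_split:
  assumes "m \<le> n"
  shows "(\<Sum>u\<in>words n. f u) = (\<Sum>w\<in>words (n - m). \<Sum>u\<in>words m. f (u @ w))"
proof -
  have bij: "bij_betw (\<lambda>(w, u). u @ w) (words (n - m) \<times> words m) (words n)"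
  proof (rule bij_betw_byWitness[where f' = "\<lambda>v. (drop m v, take m v)"])
  qed (use assms in \<open>auto simp: words_def\<close>)
  have "(\<Sum>u\<in>words n. f u) = (\<Sum>p\<in>words (n - m) \<times> words m. f (snd p @ fst p))"
    by (subst sum.reindex_bij_betw[OF bij, symmetric]) (simp add: case_prod_beta)
  also have "\<dots> = (\<Sum>w\<in>words (n - m). \<Sum>u\<in>words m. f (u @ w))"
    by (simp add: sum.cartesian_product case_prod_beta)
  finally show ?thesis .
qed

lemma emb_append:
  "length u = m \<Longrightarrow> length u' = m \<Longrightarrow>
    emb m n x (u @ w) (u' @ w') = x u u' * ident (n - m) w w'"
  by (simp add: emb_def tensor_def)

lemma mapply_emb:
  assumes "m \<le> n" "u \<in> words m" "w \<in> words (n - m)"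
  shows "mapply n (emb m n x) \<xi> (u @ w) = mapply m x (\<lambda>v. \<xi> (v @ w)) u"
proof -
  have "mapply n (emb m n x) \<xi> (u @ w)
      = (\<Sum>w'\<in>words (n - m). \<Sum>u'\<in>words m. emb m n x (u @ w) (u' @ w') * \<xi> (u' @ w'))"
    unfolding mapply_def by (rule sum_words_split[OF assms(1)])
  also have "\<dots> = (\<Sum>w'\<in>words (n - m). if w' = w then \<Sum>u'\<in>words m. x u u' * \<xi> (u' @ w') else 0)"
    using assms by (intro sum.cong) (auto simp: words_def emb_append ident_def intro: sum.neutral)
  also have "\<dots> = mapply m x (\<lambda>v. \<xi> (v @ w)) u"
    using assms by (simp add: mapply_def)
  finally show ?thesis .
qed

lemma l2_split:
  assumes "m \<le> n"
  shows "(l2 n \<xi>)\<^sup>2 = (\<Sum>w\<in>words (n - m). (l2 m (\<lambda>u. \<xi> (u @ w)))\<^sup>2)"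
  unfolding l2_sq by (rule sum_words_split[OF assms])

lemma opnorm_emb:
  assumes "m \<le> n"
  shows "opnorm n (emb m n x) = opnorm m x"
proof (rule antisym)
  show "opnorm n (emb m n x) \<le> opnorm m x"
  proof (rule opnorm_leI)
    fix \<xi>
    have "(l2 n (mapply n (emb m n x) \<xi>))\<^sup>2
        = (\<Sum>w\<in>words (n - m). (l2 m (mapply m x (\<lambda>v. \<xi> (v @ w))))\<^sup>2)"
      unfolding l2_split[OF assms]
      by (intro sum.cong arg_cong[where f = "\<lambda>t. t\<^sup>2"])
         (auto simp: l2_def mapply_emb[OF assms] intro!: L2_set_cong)
    also have "\<dots> \<le> (\<Sum>w\<in>words (n - m). (opnorm m x * l2 m (\<lambda>v. \<xi> (v @ w)))\<^sup>2)"
      by (intro sum_mono power_mono opnorm_bound) simp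
    also have "\<dots> = (opnorm m x * l2 n \<xi>)\<^sup>2"
      by (simp add: power_mult_distrib l2_split[OF assms] sum_distrib_left)
    finally show "l2 n (mapply n (emb m n x) \<xi>) \<le> opnorm m x * l2 n \<xi>"
      by (rule power2_le_imp_le) simp
  qed simp
next
  show "opnorm m x \<le> opnorm n (emb m n x)"
  proof (rule opnorm_leI)
    fix \<xi> :: "word3 \<Rightarrow> complex"
    obtain w0 where w0: "w0 \<in> words (n - m)"
      using words_nonempty by blast
    define \<eta> where "\<eta> = (\<lambda>v. if drop m v = w0 then \<xi> (take m v) else 0)"
    have \<eta>: "l2 m (\<lambda>u. \<eta> (u @ w)) = (if w = w0 then l2 m \<xi> else 0)" for w
      unfolding \<eta>_def l2_def
      by (auto simp: words_def intro!: L2_set_cong L2_set_0')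
    have "(l2 n \<eta>)\<^sup>2 = (\<Sum>w\<in>words (n - m). if w = w0 then (l2 m \<xi>)\<^sup>2 else 0)"
      unfolding l2_split[OF assms] \<eta> by (intro sum.cong) auto
    then have n1: "l2 n \<eta> = l2 m \<xi>"
      using w0 by (simp add: power2_eq_iff_nonneg)
    have "mapply n (emb m n x) \<eta> (u @ w0) = mapply m x \<xi> u" if u: "u \<in> words m" for u
      unfolding mapply_emb[OF assms u w0]
      unfolding mapply_def by (rule sum.cong) (auto simp: \<eta>_def words_def)
    then have "(l2 m (mapply m x \<xi>))\<^sup>2 = (l2 m (\<lambda>u. mapply n (emb m n x) \<eta> (u @ w0)))\<^sup>2"
      by (simp add: l2_def cong: L2_set_cong_simp)
    also have "\<dots> \<le> (l2 n (mapply n (emb m n x) \<eta>))\<^sup>2"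
      unfolding l2_split[OF assms, of "mapply n (emb m n x) \<eta>"]
      by (rule member_le_sum) (use w0 in auto)
    finally have "l2 m (mapply m x \<xi>) \<le> l2 n (mapply n (emb m n x) \<eta>)"
      by (rule power2_le_imp_le) simp
    then show "l2 m (mapply m x \<xi>) \<le> opnorm n (emb m n x) * l2 m \<xi>"
      using opnorm_bound[of n "emb m n x" \<eta>] n1 by simp
  qed simp
qed

lemma emb_self:
  assumes "x \<in> Mat n"
  shows "emb n n x = x"
proof (intro ext)
  fix u v
  show "emb n n x u v = x u v"
  proof (cases "u \<in> words n \<and> v \<in> words n")
    case True
    then show ?thesis
      by (simp add: emb_def tensor_def ident_def words_def)
  next
    case False
    then show ?thesis
      using Mat_D[OF assms, of u v] Mat_D[OF Mat_emb[OF assms order_refl], of u v] by simp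
  qed
qed

lemma ident_append:
  "ident p (take p a) (take p b) * ident q (drop p a) (drop p b) = ident (p + q) a b"
proof -
  have "take p a \<in> words p \<and> take p a = take p b \<and> drop p a \<in> words q \<and> drop p a = drop p b
    \<longleftrightarrow> a \<in> words (p + q) \<and> a = b"
    unfolding words_def by (auto, metis append_take_drop_id)
  then show ?thesis
    unfolding ident_def by auto
qed

lemma emb_emb:
  assumes "k \<le> m" "m \<le> n"
  shows "emb m n (emb k m x) = emb k n x"
proof (intro ext)
  fix u v :: word3
  have *: "drop k (take m y) = take (m - k) (drop k y)" "drop m y = drop (m - k) (drop k y)"
    for y :: word3
    using assms by (simp_all add: drop_take)
  have "ident (m - k) (drop k (take m u)) (drop k (take m v)) * ident (n - m) (drop m u) (drop m v)
      = ident (n - k) (drop k u) (drop k v)"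
    unfolding * ident_append using assms by simp
  then show "emb m n (emb k m x) u v = emb k n x u v"
    using assms by (simp add: emb_def tensor_def min_absorb1 mult.assoc)
qed

lemma emb_add: "emb m n (x + y) = emb m n x + emb m n y"
  by (simp add: emb_def tensor_def fun_eq_iff algebra_simps)

lemma emb_diff: "emb m n (x - y) = emb m n x - emb m n y"
  by (simp add: emb_def tensor_def fun_eq_iff algebra_simps)

lemma emb_zero [simp]: "emb m n 0 = 0"
  by (simp add: emb_def tensor_def fun_eq_iff)

lemma emb_scale: "emb m n (mscale c x) = mscale c (emb m n x)"
  by (simp add: emb_def tensor_def mscale_def fun_eq_iff)

lemma emb_adj: "emb m n (adj x) = adj (emb m n x)"
  by (auto simp: emb_def tensor_def adj_def ident_def fun_eq_iff)

lemma emb_ident: "m \<le> n \<Longrightarrow> emb m n (ident m) = ident n"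
  by (simp add: emb_def tensor_def fun_eq_iff ident_append)

lemma emb_mmult:
  assumes "m \<le> n"
  shows "emb m n (mmult m x y) = mmult n (emb m n x) (emb m n y)"
proof (intro ext)
  fix u v :: word3
  let ?I = "ident (n - m)"
  have one: "(\<Sum>w\<in>words (n - m). ?I a w * ?I w b) = ?I a b" for a b
  proof -
    have "(\<Sum>w\<in>words (n - m). ?I a w * ?I w b) = (\<Sum>w\<in>words (n - m). if w = a then ?I a b else 0)"
      by (rule sum.cong) (auto simp: ident_def)
    then show ?thesis
      by (auto simp: ident_def)
  qed
  have "mmult n (emb m n x) (emb m n y) u v
      = (\<Sum>w\<in>words (n - m). \<Sum>z\<in>words m.
          (x (take m u) z * y z (take m v)) * (?I (drop m u) w * ?I w (drop m v)))"
    unfolding mmult_def sum_words_split[OF assms]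
    by (intro sum.cong refl) (simp add: emb_def tensor_def words_def mult_ac)
  also have "\<dots> = (\<Sum>z\<in>words m. x (take m u) z * y z (take m v))
      * (\<Sum>w\<in>words (n - m). ?I (drop m u) w * ?I w (drop m v))"
    unfolding sum_product by (rule sum.swap)
  also have "\<dots> = emb m n (mmult m x y) u v"
    by (simp add: one emb_def tensor_def mmult_def)
  finally show "emb m n (mmult m x y) u v = mmult n (emb m n x) (emb m n y) u v"
    by simp
qed

lemma mmult_assoc: "mmult n (mmult n x y) z = mmult n x (mmult n y z)"
  unfolding mmult_def
  by (auto simp: sum_distrib_left sum_distrib_right mult_ac fun_eq_iff intro: sum.swap)

lemma mmult_add_left: "mmult n (x + y) z = mmult n x z + mmult n y z"
  by (simp add: mmult_def fun_eq_iff algebra_simps sum.distrib)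

lemma mmult_add_right: "mmult n x (y + z) = mmult n x y + mmult n x z"
  by (simp add: mmult_def fun_eq_iff algebra_simps sum.distrib)

lemma mmult_zero_left [simp]: "mmult n 0 y = 0"
  by (simp add: mmult_def fun_eq_iff)

lemma adj_zero [simp]: "adj 0 = 0"
  by (simp add: adj_def fun_eq_iff)

lemma mmult_diff_left: "mmult n (x - y) z = mmult n x z - mmult n y z"
  by (simp add: mmult_def fun_eq_iff algebra_simps sum_subtractf)

lemma mmult_diff_right: "mmult n x (y - z) = mmult n x y - mmult n x z"
  by (simp add: mmult_def fun_eq_iff algebra_simps sum_subtractf)

lemma mmult_scale_left: "mmult n (mscale c x) y = mscale c (mmult n x y)"
  by (simp add: mmult_def mscale_def fun_eq_iff sum_distrib_left mult_ac)

lemma mmult_scale_right: "mmult n x (mscale c y) = mscale c (mmult n x y)"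
  by (simp add: mmult_def mscale_def fun_eq_iff sum_distrib_left mult_ac)

lemma mmult_ident_left:
  assumes "x \<in> Mat n"
  shows "mmult n (ident n) x = x"
proof (intro ext)
  fix u v
  have "mmult n (ident n) x u v = (\<Sum>w\<in>words n. if w = u then x u v else 0)"
    unfolding mmult_def by (rule sum.cong) (auto simp: ident_def)
  then show "mmult n (ident n) x u v = x u v"
    using Mat_D[OF assms, of u v] by auto
qed

lemma mmult_ident_right:
  assumes "x \<in> Mat n"
  shows "mmult n x (ident n) = x"
proof (intro ext)
  fix u v
  have "mmult n x (ident n) u v = (\<Sum>w\<in>words n. if w = v then x u v else 0)"
    unfolding mmult_def by (rule sum.cong) (auto simp: ident_def)
  then show "mmult n x (ident n) u v = x u v"
    using Mat_D[OF assms, of u v] by auto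
qed

lemma adj_mmult: "adj (mmult n x y) = mmult n (adj y) (adj x)"
  by (simp add: adj_def mmult_def fun_eq_iff mult_ac)

lemma adj_add: "adj (x + y) = adj x + adj y"
  by (simp add: adj_def fun_eq_iff)

lemma adj_diff: "adj (x - y) = adj x - adj y"
  by (simp add: adj_def fun_eq_iff)

lemma adj_scale: "adj (mscale c x) = mscale (cnj c) (adj x)"
  by (simp add: adj_def mscale_def fun_eq_iff)


section \<open>The UHF algebra\<close>

text \<open>
  The C*-inductive limit of the $M_3(\mathbb C)^{\otimes n}$ is the completion of their union.  Its
  elements are the classes of the sequences $(x_n)$ with $x_n\in M_3(\mathbb C)^{\otimes n}$ that
  are Cauchy under the connecting embeddings, modulo those with $\|x_n\|\to 0$; the operations are
  termwise and the norm is $\lim_n\|x_n\|$.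
\<close>

definition uhf_cauchy :: "(nat \<Rightarrow> mat) \<Rightarrow> bool" where
  "uhf_cauchy x \<longleftrightarrow> (\<forall>n. x n \<in> Mat n) \<and>
    (\<forall>e>0. \<exists>N. \<forall>m\<ge>N. \<forall>n\<ge>m. opnorm n (x n - emb m n (x m)) < e)"

definition uhf_rel :: "(nat \<Rightarrow> mat) \<Rightarrow> (nat \<Rightarrow> mat) \<Rightarrow> bool" where
  "uhf_rel x y \<longleftrightarrow> uhf_cauchy x \<and> uhf_cauchy y \<and> (\<lambda>n. opnorm n (x n - y n)) \<longlonglongrightarrow> 0"

lemma uhf_cauchyI:
  assumes "\<And>n. x n \<in> Mat n"
    and "\<And>e. 0 < e \<Longrightarrow> \<exists>N. \<forall>m\<ge>N. \<forall>n\<ge>m. opnorm n (x n - emb m n (x m)) < e"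
  shows "uhf_cauchy x"
  using assms by (simp add: uhf_cauchy_def)

lemma uhf_cauchy_Mat: "uhf_cauchy x \<Longrightarrow> x n \<in> Mat n"
  by (simp add: uhf_cauchy_def)

lemma uhf_cauchyD:
  assumes "uhf_cauchy x" "0 < e"
  obtains N where "\<And>m n. N \<le> m \<Longrightarrow> m \<le> n \<Longrightarrow> opnorm n (x n - emb m n (x m)) < e"
  using assms unfolding uhf_cauchy_def by blast

lemma uhf_rel_refl_iff: "uhf_rel x x \<longleftrightarrow> uhf_cauchy x"
  by (simp add: uhf_rel_def)

lemma uhf_cauchy_zero: "uhf_cauchy (\<lambda>n. 0)"
  by (rule uhf_cauchyI) (auto simp: Mat_zero)

lemma uhf_cauchy_ident: "uhf_cauchy ident"
  by (rule uhf_cauchyI) (auto simp: Mat_ident emb_ident)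

lemma uhf_cauchy_norm_convergent:
  assumes "uhf_cauchy x"
  shows "(\<lambda>n. opnorm n (x n)) \<longlonglongrightarrow> lim (\<lambda>n. opnorm n (x n))"
proof -
  have "Cauchy (\<lambda>n. opnorm n (x n))"
  proof (rule CauchyI')
    fix e :: real assume "0 < e"
    from uhf_cauchyD[OF assms this] obtain N
      where N: "\<And>m n. N \<le> m \<Longrightarrow> m \<le> n \<Longrightarrow> opnorm n (x n - emb m n (x m)) < e" by blast
    have "dist (opnorm m (x m)) (opnorm n (x n)) < e" if "N \<le> m" "m < n" for m n
    proof -
      have "opnorm m (x m) = opnorm n (emb m n (x m))"
        using that by (simp add: opnorm_emb)
      then show ?thesis
        using N[of m n] that opnorm_triangle_abs[of n "x n" "emb m n (x m)"]
        by (simp add: dist_real_def abs_minus_commute)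
    qed
    then show "\<exists>M. \<forall>m\<ge>M. \<forall>n>m. dist (opnorm m (x m)) (opnorm n (x n)) < e"
      by blast
  qed
  then show ?thesis
    by (simp add: Cauchy_convergent_iff convergent_LIMSEQ_iff)
qed

lemma uhf_cauchy_add:
  assumes "uhf_cauchy x" "uhf_cauchy y"
  shows "uhf_cauchy (\<lambda>n. x n + y n)"
proof (rule uhf_cauchyI)
  fix e :: real assume "0 < e"
  then have e: "0 < e / 2" by simp
  from uhf_cauchyD[OF assms(1) e] obtain N1
    where N1: "\<And>m n. N1 \<le> m \<Longrightarrow> m \<le> n \<Longrightarrow> opnorm n (x n - emb m n (x m)) < e / 2" by blast
  from uhf_cauchyD[OF assms(2) e] obtain N2
    where N2: "\<And>m n. N2 \<le> m \<Longrightarrow> m \<le> n \<Longrightarrow> opnorm n (y n - emb m n (y m)) < e / 2" by blast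
  have "opnorm n (x n + y n - emb m n (x m + y m)) < e" if "max N1 N2 \<le> m" "m \<le> n" for m n
  proof -
    have *: "x n + y n - emb m n (x m + y m) = (x n - emb m n (x m)) + (y n - emb m n (y m))"
      by (simp add: emb_add)
    show ?thesis
      unfolding *
      using opnorm_triangle[of n "x n - emb m n (x m)" "y n - emb m n (y m)"] N1[of m n] N2[of m n] that
      by simp
  qed
  then show "\<exists>N. \<forall>m\<ge>N. \<forall>n\<ge>m. opnorm n (x n + y n - emb m n (x m + y m)) < e"
    by blast
qed (use assms in \<open>simp add: uhf_cauchy_Mat Mat_add\<close>)

lemma uhf_cauchy_scale:
  assumes "uhf_cauchy x"
  shows "uhf_cauchy (\<lambda>n. mscale c (x n))"
proof (rule uhf_cauchyI)
  fix e :: real assume "0 < e"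
  then have e: "0 < e / (cmod c + 1)"
    by (simp add: add_nonneg_pos)
  from uhf_cauchyD[OF assms e] obtain N
    where N: "\<And>m n. N \<le> m \<Longrightarrow> m \<le> n \<Longrightarrow> opnorm n (x n - emb m n (x m)) < e / (cmod c + 1)" by blast
  have "opnorm n (mscale c (x n) - emb m n (mscale c (x m))) < e" if "N \<le> m" "m \<le> n" for m n
  proof -
    let ?t = "opnorm n (x n - emb m n (x m))"
    have *: "mscale c (x n) - emb m n (mscale c (x m)) = mscale c (x n - emb m n (x m))"
      by (simp add: emb_scale mat.scale_right_diff_distrib)
    have "?t * (cmod c + 1) < e"
      using N[OF that] by (subst (asm) pos_less_divide_eq) (simp_all add: add_nonneg_pos)
    then show ?thesis
      unfolding * opnorm_scale
      using opnorm_nonneg[of n "x n - emb m n (x m)"] by (simp only: distrib_left mult_1_right mult.commute[of "cmod c"])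
  qed
  then show "\<exists>N. \<forall>m\<ge>N. \<forall>n\<ge>m. opnorm n (mscale c (x n) - emb m n (mscale c (x m))) < e"
    by blast
qed (use assms in \<open>simp add: uhf_cauchy_Mat Mat_scale\<close>)

lemma mscale_minus_one: "mscale (- 1) x = - x"
  by (simp add: mscale_def fun_eq_iff)

lemma uhf_cauchy_uminus: "uhf_cauchy x \<Longrightarrow> uhf_cauchy (\<lambda>n. - x n)"
  using uhf_cauchy_scale[of x "- 1"] by (simp only: mscale_minus_one)

lemma uhf_cauchy_diff: "uhf_cauchy x \<Longrightarrow> uhf_cauchy y \<Longrightarrow> uhf_cauchy (\<lambda>n. x n - y n)"
  using uhf_cauchy_add[of x "\<lambda>n. - y n"] uhf_cauchy_uminus[of y] by simp

lemma uhf_cauchy_adj: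
  assumes "uhf_cauchy x"
  shows "uhf_cauchy (\<lambda>n. adj (x n))"
proof -
  have "adj (x n) - emb m n (adj (x m)) = adj (x n - emb m n (x m))" for m n
    by (simp add: emb_adj adj_diff)
  then show ?thesis
    using assms by (simp add: uhf_cauchy_def Mat_adj)
qed

lemma uhf_cauchy_bounded:
  assumes "uhf_cauchy x"
  obtains K where "0 < K" "\<And>n. opnorm n (x n) \<le> K"
proof -
  have "Bseq (\<lambda>n. opnorm n (x n))"
    using uhf_cauchy_norm_convergent[OF assms] by (metis convergentI convergent_imp_Bseq)
  then obtain K where "0 < K" "\<And>n. norm (opnorm n (x n)) \<le> K"
    by (auto simp: Bseq_def)
  then show thesis
    using that by simp
qed

lemma mmult_diff_bound:
  "opnorm n (mmult n x y - mmult n x' y')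
    \<le> opnorm n x * opnorm n (y - y') + opnorm n (x - x') * opnorm n y'"
proof -
  have "mmult n x y - mmult n x' y' = mmult n x (y - y') + mmult n (x - x') y'"
    by (simp add: mmult_diff_left mmult_diff_right)
  then show ?thesis
    using opnorm_triangle[of n "mmult n x (y - y')" "mmult n (x - x') y'"]
      opnorm_mmult[of n x "y - y'"] opnorm_mmult[of n "x - x'" y'] by simp
qed

lemma uhf_cauchy_mult:
  assumes "uhf_cauchy x" "uhf_cauchy y"
  shows "uhf_cauchy (\<lambda>n. mmult n (x n) (y n))"
proof (rule uhf_cauchyI)
  fix e :: real assume "0 < e"
  from uhf_cauchy_bounded[OF assms(1)] obtain K where K: "0 < K" "\<And>n. opnorm n (x n) \<le> K" by blast
  from uhf_cauchy_bounded[OF assms(2)] obtain L where L: "0 < L" "\<And>n. opnorm n (y n) \<le> L" by blast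
  have e1: "0 < e / (2 * L)" and e2: "0 < e / (2 * K)"
    using \<open>0 < e\<close> K(1) L(1) by simp_all
  from uhf_cauchyD[OF assms(1) e1] obtain N1
    where N1: "\<And>m n. N1 \<le> m \<Longrightarrow> m \<le> n \<Longrightarrow> opnorm n (x n - emb m n (x m)) < e / (2 * L)" by blast
  from uhf_cauchyD[OF assms(2) e2] obtain N2
    where N2: "\<And>m n. N2 \<le> m \<Longrightarrow> m \<le> n \<Longrightarrow> opnorm n (y n - emb m n (y m)) < e / (2 * K)" by blast
  have "opnorm n (mmult n (x n) (y n) - emb m n (mmult m (x m) (y m))) < e"
    if mn: "max N1 N2 \<le> m" "m \<le> n" for m n
  proof -
    have "opnorm n (mmult n (x n) (y n) - emb m n (mmult m (x m) (y m)))
        \<le> opnorm n (x n) * opnorm n (y n - emb m n (y m))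
          + opnorm n (x n - emb m n (x m)) * opnorm m (y m)"
      using mmult_diff_bound[of n "x n" "y n" "emb m n (x m)" "emb m n (y m)"] mn
      by (simp add: emb_mmult opnorm_emb)
    also have "\<dots> \<le> K * opnorm n (y n - emb m n (y m)) + opnorm n (x n - emb m n (x m)) * L"
      using K L by (intro add_mono mult_mono) (auto simp: less_imp_le)
    also have "\<dots> < K * (e / (2 * K)) + (e / (2 * L)) * L"
      using K L N1[of m n] N2[of m n] mn
      by (intro add_strict_mono mult_strict_left_mono mult_strict_right_mono) auto
    also have "\<dots> = e"
      using K L by (simp add: field_simps)
    finally show ?thesis .
  qed
  then show "\<exists>N. \<forall>m\<ge>N. \<forall>n\<ge>m. opnorm n (mmult n (x n) (y n) - emb m n (mmult m (x m) (y m))) < e"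
    by blast
qed (use assms in \<open>simp add: uhf_cauchy_Mat Mat_mmult\<close>)

lemma uhf_cauchy_emb:
  assumes "x \<in> Mat m"
  shows "uhf_cauchy (\<lambda>n. if m \<le> n then emb m n x else 0)"
proof (rule uhf_cauchyI)
  fix e :: real assume "0 < e"
  then show "\<exists>N. \<forall>k\<ge>N. \<forall>n\<ge>k. opnorm n ((if m \<le> n then emb m n x else 0)
      - emb k n (if m \<le> k then emb m k x else 0)) < e"
    by (intro exI[of _ m]) (auto simp: emb_emb)
qed (use assms in \<open>auto simp: Mat_emb Mat_zero\<close>)

lemma uhf_relI:
  assumes "uhf_cauchy x" "uhf_cauchy y" "\<And>n. opnorm n (x n - y n) \<le> f n" "f \<longlonglongrightarrow> 0"
  shows "uhf_rel x y"
proof -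
  have "(\<lambda>n. opnorm n (x n - y n)) \<longlonglongrightarrow> 0"
    by (rule Lim_null_comparison[OF _ assms(4)]) (simp add: assms(3))
  then show ?thesis
    using assms by (simp add: uhf_rel_def)
qed

quotient_type uhf = "nat \<Rightarrow> mat" / partial: uhf_rel
proof (rule part_equivpI)
  show "\<exists>x. uhf_rel x x"
    using uhf_cauchy_zero uhf_rel_refl_iff by blast
  show "symp uhf_rel"
    by (rule sympI) (simp add: uhf_rel_def opnorm_minus_commute)
  show "transp uhf_rel"
  proof (rule transpI)
    fix x y z assume xy: "uhf_rel x y" and yz: "uhf_rel y z"
    have "(\<lambda>n. opnorm n (x n - y n) + opnorm n (y n - z n)) \<longlonglongrightarrow> 0"
      using xy yz unfolding uhf_rel_def by (intro tendsto_add_zero) auto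
    then show "uhf_rel x z"
      using xy yz opnorm_diff_triangle by (intro uhf_relI) (auto simp: uhf_rel_def)
  qed
qed

lemma uhf_rel_norm_lim:
  assumes "uhf_rel x y"
  shows "lim (\<lambda>n. opnorm n (x n)) = lim (\<lambda>n. opnorm n (y n))"
proof -
  have d: "(\<lambda>n. opnorm n (x n - y n)) \<longlonglongrightarrow> 0" and x: "uhf_cauchy x" and y: "uhf_cauchy y"
    using assms by (auto simp: uhf_rel_def)
  have "(\<lambda>n. opnorm n (x n) - opnorm n (y n)) \<longlonglongrightarrow> 0"
    by (rule Lim_null_comparison[OF _ d]) (simp add: opnorm_triangle_abs)
  moreover have "(\<lambda>n. opnorm n (x n) - opnorm n (y n))
      \<longlonglongrightarrow> lim (\<lambda>n. opnorm n (x n)) - lim (\<lambda>n. opnorm n (y n))"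
    by (intro tendsto_diff uhf_cauchy_norm_convergent x y)
  ultimately show ?thesis
    using LIMSEQ_unique by fastforce
qed

instantiation uhf :: "{zero, one, plus, minus, uminus, times, scaleR, norm}"
begin

lift_definition zero_uhf :: uhf is "\<lambda>n. 0"
  by (simp add: uhf_rel_refl_iff uhf_cauchy_zero)

lift_definition one_uhf :: uhf is ident
  by (simp add: uhf_rel_refl_iff uhf_cauchy_ident)

lift_definition plus_uhf :: "uhf \<Rightarrow> uhf \<Rightarrow> uhf" is "\<lambda>x y n. x n + y n"
proof -
  fix x x' y y' assume "uhf_rel x x'" "uhf_rel y y'"
  then show "uhf_rel (\<lambda>n. x n + y n) (\<lambda>n. x' n + y' n)"
    by (intro uhf_relI[where f = "\<lambda>n. opnorm n (x n - x' n) + opnorm n (y n - y' n)"])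
       (auto simp: uhf_rel_def uhf_cauchy_add add_diff_add opnorm_triangle intro: tendsto_add_zero)
qed

lift_definition uminus_uhf :: "uhf \<Rightarrow> uhf" is "\<lambda>x n. - x n"
proof -
  fix x x' assume "uhf_rel x x'"
  then show "uhf_rel (\<lambda>n. - x n) (\<lambda>n. - x' n)"
    by (intro uhf_relI[where f = "\<lambda>n. opnorm n (x n - x' n)"])
       (auto simp: uhf_rel_def uhf_cauchy_uminus opnorm_minus_commute)
qed

lift_definition minus_uhf :: "uhf \<Rightarrow> uhf \<Rightarrow> uhf" is "\<lambda>x y n. x n - y n"
proof -
  fix x x' y y' assume xy: "uhf_rel x x'" "uhf_rel y y'"
  have "opnorm n (x n - y n - (x' n - y' n)) \<le> opnorm n (x n - x' n) + opnorm n (y n - y' n)" for n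
    using opnorm_triangle[of n "x n - x' n" "y' n - y n"] opnorm_minus_commute[of n "y n" "y' n"]
    by (simp add: algebra_simps)
  then show "uhf_rel (\<lambda>n. x n - y n) (\<lambda>n. x' n - y' n)"
    using xy by (intro uhf_relI[where f = "\<lambda>n. opnorm n (x n - x' n) + opnorm n (y n - y' n)"])
      (auto simp: uhf_rel_def uhf_cauchy_diff intro: tendsto_add_zero)
qed

lift_definition times_uhf :: "uhf \<Rightarrow> uhf \<Rightarrow> uhf" is "\<lambda>x y n. mmult n (x n) (y n)"
proof -
  fix x x' y y' assume xy: "uhf_rel x x'" "uhf_rel y y'"
  let ?f = "\<lambda>n. opnorm n (x n) * opnorm n (y n - y' n) + opnorm n (x n - x' n) * opnorm n (y' n)"
  have "?f \<longlonglongrightarrow> lim (\<lambda>n. opnorm n (x n)) * 0 + 0 * lim (\<lambda>n. opnorm n (y' n))"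
    using xy unfolding uhf_rel_def
    by (intro tendsto_add tendsto_mult uhf_cauchy_norm_convergent) auto
  then show "uhf_rel (\<lambda>n. mmult n (x n) (y n)) (\<lambda>n. mmult n (x' n) (y' n))"
    using xy by (intro uhf_relI[where f = ?f])
      (auto simp: uhf_rel_def uhf_cauchy_mult mmult_diff_bound)
qed

lift_definition scaleR_uhf :: "real \<Rightarrow> uhf \<Rightarrow> uhf" is "\<lambda>r x n. mscale (complex_of_real r) (x n)"
proof -
  fix r :: real and x x' assume "uhf_rel x x'"
  then show "uhf_rel (\<lambda>n. mscale (complex_of_real r) (x n)) (\<lambda>n. mscale (complex_of_real r) (x' n))"
    by (intro uhf_relI[where f = "\<lambda>n. \<bar>r\<bar> * opnorm n (x n - x' n)"])
       (auto simp: uhf_rel_def uhf_cauchy_scale opnorm_scale tendsto_mult_right_zero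
         simp flip: mat.scale_right_diff_distrib)
qed

lift_definition norm_uhf :: "uhf \<Rightarrow> real" is "\<lambda>x. lim (\<lambda>n. opnorm n (x n))"
  by (rule uhf_rel_norm_lim)

instance ..

end

instantiation uhf :: real_normed_algebra_1
begin

definition sgn_uhf :: "uhf \<Rightarrow> uhf" where
  "sgn_uhf x = x /\<^sub>R norm x"

definition dist_uhf :: "uhf \<Rightarrow> uhf \<Rightarrow> real" where
  "dist_uhf x y = norm (x - y)"

definition uniformity_uhf :: "(uhf \<times> uhf) filter" where
  "uniformity_uhf = (INF e\<in>{0<..}. principal {(x, y). dist x y < e})"

definition open_uhf :: "uhf set \<Rightarrow> bool" where
  "open_uhf U \<longleftrightarrow> (\<forall>x\<in>U. eventually (\<lambda>(x', y). x' = x \<longrightarrow> y \<in> U) uniformity)"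

instance
proof
  fix x y z :: uhf and a b :: real
  show "x + y + z = x + (y + z)"
    by transfer (simp add: uhf_rel_refl_iff uhf_cauchy_add add.assoc)
  show "x + y = y + x"
    by transfer (simp add: uhf_rel_refl_iff uhf_cauchy_add add.commute)
  show "0 + x = x"
    by transfer simp
  show "- x + x = 0"
    by transfer (simp add: uhf_rel_refl_iff uhf_cauchy_zero)
  show "x - y = x + - y"
    by transfer (simp add: uhf_rel_refl_iff uhf_cauchy_diff)
  show "a *\<^sub>R (x + y) = a *\<^sub>R x + a *\<^sub>R y"
    by transfer (simp add: uhf_rel_refl_iff uhf_cauchy_add uhf_cauchy_scale mat.scale_right_distrib)
  show "(a + b) *\<^sub>R x = a *\<^sub>R x + b *\<^sub>R x"
    by transfer (simp add: uhf_rel_refl_iff uhf_cauchy_add uhf_cauchy_scale mat.scale_left_distrib)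
  show "a *\<^sub>R b *\<^sub>R x = (a * b) *\<^sub>R x"
    by transfer (simp add: uhf_rel_refl_iff uhf_cauchy_scale)
  show "1 *\<^sub>R x = x"
    by transfer simp
  show "x * y * z = x * (y * z)"
    by transfer (simp add: uhf_rel_refl_iff uhf_cauchy_mult mmult_assoc)
  show "(x + y) * z = x * z + y * z"
    by transfer (simp add: uhf_rel_refl_iff uhf_cauchy_add uhf_cauchy_mult mmult_add_left)
  show "x * (y + z) = x * y + x * z"
    by transfer (simp add: uhf_rel_refl_iff uhf_cauchy_add uhf_cauchy_mult mmult_add_right)
  show "a *\<^sub>R x * y = a *\<^sub>R (x * y)"
    by transfer (simp add: uhf_rel_refl_iff uhf_cauchy_scale uhf_cauchy_mult mmult_scale_left)
  show "x * a *\<^sub>R y = a *\<^sub>R (x * y)"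
    by transfer (simp add: uhf_rel_refl_iff uhf_cauchy_scale uhf_cauchy_mult mmult_scale_right)
  show "1 * x = x"
    by transfer (simp add: uhf_rel_refl_iff mmult_ident_left uhf_cauchy_Mat)
  show "x * 1 = x"
    by transfer (simp add: uhf_rel_refl_iff mmult_ident_right uhf_cauchy_Mat)
  show one: "norm (1 :: uhf) = 1"
    by transfer simp
  have "norm (0 :: uhf) = 0"
    by transfer simp
  then show "(0 :: uhf) \<noteq> 1"
    using one by force
  show "norm x = 0 \<longleftrightarrow> x = 0"
  proof (transfer, unfold uhf_rel_refl_iff)
    fix x assume "uhf_cauchy x"
    then show "lim (\<lambda>n. opnorm n (x n)) = 0 \<longleftrightarrow> uhf_rel x (\<lambda>n. 0)"
      using uhf_cauchy_norm_convergent[of x] by (auto simp: uhf_rel_def uhf_cauchy_zero dest: limI)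
  qed
  show "norm (x + y) \<le> norm x + norm y"
  proof (transfer, unfold uhf_rel_refl_iff)
    fix x y assume "uhf_cauchy x" "uhf_cauchy y"
    then show "lim (\<lambda>n. opnorm n (x n + y n)) \<le> lim (\<lambda>n. opnorm n (x n)) + lim (\<lambda>n. opnorm n (y n))"
      by (intro LIMSEQ_le[OF uhf_cauchy_norm_convergent[OF uhf_cauchy_add]
            tendsto_add[OF uhf_cauchy_norm_convergent uhf_cauchy_norm_convergent]])
         (auto simp: opnorm_triangle)
  qed
  show "norm (x * y) \<le> norm x * norm y"
  proof (transfer, unfold uhf_rel_refl_iff)
    fix x y assume "uhf_cauchy x" "uhf_cauchy y"
    then show "lim (\<lambda>n. opnorm n (mmult n (x n) (y n)))
        \<le> lim (\<lambda>n. opnorm n (x n)) * lim (\<lambda>n. opnorm n (y n))"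
      by (intro LIMSEQ_le[OF uhf_cauchy_norm_convergent[OF uhf_cauchy_mult]
            tendsto_mult[OF uhf_cauchy_norm_convergent uhf_cauchy_norm_convergent]])
         (auto simp: opnorm_mmult)
  qed
  show "norm (a *\<^sub>R x) = \<bar>a\<bar> * norm x"
  proof (transfer, unfold uhf_rel_refl_iff)
    fix a :: real and x assume "uhf_cauchy x"
    then show "lim (\<lambda>n. opnorm n (mscale (complex_of_real a) (x n))) = \<bar>a\<bar> * lim (\<lambda>n. opnorm n (x n))"
      by (intro limI) (simp add: opnorm_scale tendsto_mult_left uhf_cauchy_norm_convergent)
  qed
qed (auto simp: sgn_uhf_def dist_uhf_def uniformity_uhf_def open_uhf_def)

end

lift_definition uadj :: "uhf \<Rightarrow> uhf" is "\<lambda>x n. adj (x n)"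
proof -
  fix x x' assume "uhf_rel x x'"
  then show "uhf_rel (\<lambda>n. adj (x n)) (\<lambda>n. adj (x' n))"
    by (intro uhf_relI[where f = "\<lambda>n. opnorm n (x n - x' n)"])
       (auto simp: uhf_rel_def uhf_cauchy_adj simp flip: adj_diff)
qed

lift_definition uscale :: "complex \<Rightarrow> uhf \<Rightarrow> uhf" is "\<lambda>c x n. mscale c (x n)"
proof -
  fix c :: complex and x x' assume "uhf_rel x x'"
  then show "uhf_rel (\<lambda>n. mscale c (x n)) (\<lambda>n. mscale c (x' n))"
    by (intro uhf_relI[where f = "\<lambda>n. cmod c * opnorm n (x n - x' n)"])
       (auto simp: uhf_rel_def uhf_cauchy_scale opnorm_scale tendsto_mult_right_zero
         simp flip: mat.scale_right_diff_distrib)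
qed

global_interpretation uhf: vector_space uscale
proof
  fix a b :: complex and x y :: uhf
  show "uscale a (x + y) = uscale a x + uscale a y"
    by transfer (simp add: uhf_rel_refl_iff uhf_cauchy_add uhf_cauchy_scale mat.scale_right_distrib)
  show "uscale (a + b) x = uscale a x + uscale b x"
    by transfer (simp add: uhf_rel_refl_iff uhf_cauchy_add uhf_cauchy_scale mat.scale_left_distrib)
  show "uscale a (uscale b x) = uscale (a * b) x"
    by transfer (simp add: uhf_rel_refl_iff uhf_cauchy_scale)
  show "uscale 1 x = x"
    by transfer simp
qed

lemma uscale_of_real: "uscale (complex_of_real r) x = r *\<^sub>R x"
  by transfer (simp add: uhf_rel_refl_iff uhf_cauchy_scale)

lemma norm_uscale: "norm (uscale c x) = cmod c * norm x"
proof (transfer, unfold uhf_rel_refl_iff)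
  fix c and x assume "uhf_cauchy x"
  then show "lim (\<lambda>n. opnorm n (mscale c (x n))) = cmod c * lim (\<lambda>n. opnorm n (x n))"
    by (intro limI) (simp add: opnorm_scale tendsto_mult_left uhf_cauchy_norm_convergent)
qed

lemma uscale_mult_left: "uscale c x * y = uscale c (x * y)"
  by transfer (simp add: uhf_rel_refl_iff uhf_cauchy_scale uhf_cauchy_mult mmult_scale_left)

lemma uscale_mult_right: "x * uscale c y = uscale c (x * y)"
  by transfer (simp add: uhf_rel_refl_iff uhf_cauchy_scale uhf_cauchy_mult mmult_scale_right)

lemma uadj_uadj: "uadj (uadj x) = x"
  by transfer simp

lemma uadj_add: "uadj (x + y) = uadj x + uadj y"
  by transfer (simp add: uhf_rel_refl_iff uhf_cauchy_add uhf_cauchy_adj adj_add)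

lemma uadj_uscale: "uadj (uscale c x) = uscale (cnj c) (uadj x)"
  by transfer (simp add: uhf_rel_refl_iff uhf_cauchy_scale uhf_cauchy_adj adj_scale)

lemma uadj_mult: "uadj (x * y) = uadj y * uadj x"
  by transfer (simp add: uhf_rel_refl_iff uhf_cauchy_mult uhf_cauchy_adj adj_mmult)

lemma norm_uadj_mult: "norm (uadj x * x) = (norm x)\<^sup>2"
proof (transfer, unfold uhf_rel_refl_iff)
  fix x assume "uhf_cauchy x"
  then show "lim (\<lambda>n. opnorm n (mmult n (adj (x n)) (x n))) = (lim (\<lambda>n. opnorm n (x n)))\<^sup>2"
    by (intro limI) (simp add: opnorm_cstar tendsto_power uhf_cauchy_norm_convergent)
qed

text \<open>The embedding of $M_3(\mathbb C)^{\otimes m}$ into the UHF algebra (with junk value \<open>0\<close> on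
  matrices that are not of level \<open>m\<close>).\<close>

lift_definition iota :: "nat \<Rightarrow> mat \<Rightarrow> uhf" is
  "\<lambda>m x n. if x \<in> Mat m \<and> m \<le> n then emb m n x else 0"
proof -
  fix m x
  show "uhf_rel (\<lambda>n. if x \<in> Mat m \<and> m \<le> n then emb m n x else 0)
      (\<lambda>n. if x \<in> Mat m \<and> m \<le> n then emb m n x else 0)"
    using uhf_cauchy_emb[of x m] uhf_cauchy_zero by (cases "x \<in> Mat m") (auto simp: uhf_rel_refl_iff)
qed

lemma iota_emb:
  assumes "x \<in> Mat m" "m \<le> n"
  shows "iota n (emb m n x) = iota m x"
proof (transfer fixing: m n x)
  show "uhf_rel (\<lambda>k. if emb m n x \<in> Mat n \<and> n \<le> k then emb n k (emb m n x) else 0)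
      (\<lambda>k. if x \<in> Mat m \<and> m \<le> k then emb m k x else 0)"
    unfolding uhf_rel_def
  proof (intro conjI)
    show "uhf_cauchy (\<lambda>k. if emb m n x \<in> Mat n \<and> n \<le> k then emb n k (emb m n x) else 0)"
      using uhf_cauchy_emb[OF Mat_emb[OF assms]] Mat_emb[OF assms] by simp
    show "uhf_cauchy (\<lambda>k. if x \<in> Mat m \<and> m \<le> k then emb m k x else 0)"
      using uhf_cauchy_emb[OF assms(1)] assms(1) by simp
    show "(\<lambda>k. opnorm k ((if emb m n x \<in> Mat n \<and> n \<le> k then emb n k (emb m n x) else 0)
        - (if x \<in> Mat m \<and> m \<le> k then emb m k x else 0))) \<longlonglongrightarrow> 0"
      by (rule tendsto_eventually, rule eventually_sequentiallyI[of n])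
         (use assms in \<open>simp add: Mat_emb emb_emb\<close>)
  qed
qed

lemma norm_iota:
  assumes "x \<in> Mat m"
  shows "norm (iota m x) = opnorm m x"
proof (transfer fixing: m x)
  show "lim (\<lambda>k. opnorm k (if x \<in> Mat m \<and> m \<le> k then emb m k x else 0)) = opnorm m x"
    by (rule limI, rule tendsto_eventually, rule eventually_sequentiallyI[of m])
       (use assms in \<open>simp add: opnorm_emb\<close>)
qed

lemma iota_add:
  assumes "x \<in> Mat m" "y \<in> Mat m"
  shows "iota m (x + y) = iota m x + iota m y"
proof (transfer fixing: m x y)
  have "(\<lambda>n. if x + y \<in> Mat m \<and> m \<le> n then emb m n (x + y) else 0)
      = (\<lambda>n. (if x \<in> Mat m \<and> m \<le> n then emb m n x else 0) + (if y \<in> Mat m \<and> m \<le> n then emb m n y else 0))"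
    using assms by (auto simp: Mat_add emb_add)
  then show "uhf_rel (\<lambda>n. if x + y \<in> Mat m \<and> m \<le> n then emb m n (x + y) else 0)
      (\<lambda>n. (if x \<in> Mat m \<and> m \<le> n then emb m n x else 0) + (if y \<in> Mat m \<and> m \<le> n then emb m n y else 0))"
    using assms uhf_cauchy_emb[of "x + y" m] by (simp add: uhf_rel_refl_iff Mat_add)
qed

lemma iota_scale:
  assumes "x \<in> Mat m"
  shows "iota m (mscale c x) = uscale c (iota m x)"
proof (transfer fixing: m x c)
  have "(\<lambda>n. if mscale c x \<in> Mat m \<and> m \<le> n then emb m n (mscale c x) else 0)
      = (\<lambda>n. mscale c (if x \<in> Mat m \<and> m \<le> n then emb m n x else 0))"
    using assms by (auto simp: Mat_scale emb_scale)
  then show "uhf_rel (\<lambda>n. if mscale c x \<in> Mat m \<and> m \<le> n then emb m n (mscale c x) else 0)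
      (\<lambda>n. mscale c (if x \<in> Mat m \<and> m \<le> n then emb m n x else 0))"
    using assms uhf_cauchy_emb[of "mscale c x" m] by (simp add: uhf_rel_refl_iff Mat_scale)
qed

lemma iota_diff:
  assumes "x \<in> Mat m" "y \<in> Mat m"
  shows "iota m (x - y) = iota m x - iota m y"
  using iota_add[OF Mat_diff[OF assms] assms(2)] by (simp add: algebra_simps)

lemma iota_mmult:
  assumes "x \<in> Mat m" "y \<in> Mat m"
  shows "iota m (mmult m x y) = iota m x * iota m y"
proof (transfer fixing: m x y)
  have "(\<lambda>n. if mmult m x y \<in> Mat m \<and> m \<le> n then emb m n (mmult m x y) else 0)
      = (\<lambda>n. mmult n (if x \<in> Mat m \<and> m \<le> n then emb m n x else 0)
          (if y \<in> Mat m \<and> m \<le> n then emb m n y else 0))"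
    using assms by (auto simp: Mat_mmult emb_mmult)
  then show "uhf_rel (\<lambda>n. if mmult m x y \<in> Mat m \<and> m \<le> n then emb m n (mmult m x y) else 0)
      (\<lambda>n. mmult n (if x \<in> Mat m \<and> m \<le> n then emb m n x else 0)
          (if y \<in> Mat m \<and> m \<le> n then emb m n y else 0))"
    using assms uhf_cauchy_emb[of "mmult m x y" m] by (simp add: uhf_rel_refl_iff Mat_mmult)
qed

lemma iota_adj:
  assumes "x \<in> Mat m"
  shows "iota m (adj x) = uadj (iota m x)"
proof (transfer fixing: m x)
  have "(\<lambda>n. if adj x \<in> Mat m \<and> m \<le> n then emb m n (adj x) else 0)
      = (\<lambda>n. adj (if x \<in> Mat m \<and> m \<le> n then emb m n x else 0))"
    using assms by (auto simp: Mat_adj emb_adj)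
  then show "uhf_rel (\<lambda>n. if adj x \<in> Mat m \<and> m \<le> n then emb m n (adj x) else 0)
      (\<lambda>n. adj (if x \<in> Mat m \<and> m \<le> n then emb m n x else 0))"
    using assms uhf_cauchy_emb[of "adj x" m] by (simp add: uhf_rel_refl_iff Mat_adj)
qed

lemma iota_ident: "iota m (ident m) = 1"
proof (transfer fixing: m)
  show "uhf_rel (\<lambda>n. if ident m \<in> Mat m \<and> m \<le> n then emb m n (ident m) else 0) ident"
    unfolding uhf_rel_def
  proof (intro conjI)
    show "uhf_cauchy (\<lambda>n. if ident m \<in> Mat m \<and> m \<le> n then emb m n (ident m) else 0)"
      using uhf_cauchy_emb[OF Mat_ident] Mat_ident by simp
    show "(\<lambda>n. opnorm n ((if ident m \<in> Mat m \<and> m \<le> n then emb m n (ident m) else 0) - ident n)) \<longlonglongrightarrow> 0"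
      by (rule tendsto_eventually, rule eventually_sequentiallyI[of m]) (simp add: Mat_ident emb_ident)
  qed (rule uhf_cauchy_ident)
qed

lemma iota_tendsto:
  assumes "uhf_cauchy x"
  shows "(\<lambda>n. iota n (x n)) \<longlonglongrightarrow> abs_uhf x"
proof (rule LIMSEQ_I)
  fix e :: real assume "0 < e"
  then have e: "0 < e / 2" by simp
  from uhf_cauchyD[OF assms e] obtain N
    where N: "\<And>m n. N \<le> m \<Longrightarrow> m \<le> n \<Longrightarrow> opnorm n (x n - emb m n (x m)) < e / 2" by blast
  have "norm (iota n (x n) - abs_uhf x) < e" if n: "N \<le> n" for n
  proof -
    let ?y = "\<lambda>k. if n \<le> k then emb n k (x n) else 0"
    have y: "uhf_cauchy ?y"
      by (rule uhf_cauchy_emb[OF uhf_cauchy_Mat[OF assms]])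
    have i: "iota n (x n) = abs_uhf ?y"
      using uhf_cauchy_Mat[OF assms, of n] by (simp add: iota_def id_def)
    have d: "uhf_cauchy (\<lambda>k. ?y k - x k)"
      by (rule uhf_cauchy_diff[OF y assms])
    have "norm (iota n (x n) - abs_uhf x) = lim (\<lambda>k. opnorm k (?y k - x k))"
      using d y assms unfolding i
      by (simp add: minus_uhf.abs_eq norm_uhf.abs_eq uhf_rel_refl_iff)
    also have "\<dots> \<le> e / 2"
    proof (rule LIMSEQ_le_const2[OF uhf_cauchy_norm_convergent[OF d]])
      have "opnorm k (?y k - x k) \<le> e / 2" if "n \<le> k" for k
        using N[OF n that] that by (simp add: opnorm_minus_commute)
      then show "\<exists>K. \<forall>k\<ge>K. opnorm k (?y k - x k) \<le> e / 2" by blast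
    qed
    finally show ?thesis
      using \<open>0 < e\<close> by simp
  qed
  then show "\<exists>N. \<forall>n\<ge>N. norm (iota n (x n) - abs_uhf x) < e" by blast
qed

lemma uhf_approx:
  obtains x where "uhf_cauchy x" "(\<lambda>n. iota n (x n)) \<longlonglongrightarrow> b"
proof -
  obtain x where "b = abs_uhf x" "uhf_cauchy x"
    using uhf.abs_induct[of "\<lambda>b. \<exists>x. b = abs_uhf x \<and> uhf_cauchy x" b] uhf_rel_refl_iff by blast
  then show thesis
    using that iota_tendsto by blast
qed

lemma closure_iota: "closure (\<Union>n. iota n ` Mat n) = UNIV"
proof -
  have "b \<in> closure (\<Union>n. iota n ` Mat n)" for b
  proof -
    obtain x where "uhf_cauchy x" "(\<lambda>n. iota n (x n)) \<longlonglongrightarrow> b"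
      by (rule uhf_approx)
    then show ?thesis
      unfolding closure_sequential using uhf_cauchy_Mat by (intro exI[of _ "\<lambda>n. iota n (x n)"]) blast
  qed
  then show ?thesis by blast
qed

instance uhf :: banach
proof
  fix X :: "nat \<Rightarrow> uhf" assume X: "Cauchy X"
  have "\<exists>z\<in>Mat n. \<forall>y\<in>Mat n. norm (X n - iota n z) < norm (X n - iota n y) + 1 / Suc n" for n
  proof -
    let ?S = "(\<lambda>y. norm (X n - iota n y)) ` Mat n"
    have ne: "?S \<noteq> {}" using Mat_zero by blast
    have bd: "bdd_below ?S" by (auto intro: bdd_belowI[of _ 0])
    have "Inf ?S < Inf ?S + 1 / Suc n" by simp
    from cInf_lessD[OF ne this] obtain z
      where z: "z \<in> Mat n" "norm (X n - iota n z) < Inf ?S + 1 / Suc n" by blast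
    have "norm (X n - iota n z) < norm (X n - iota n y) + 1 / Suc n" if "y \<in> Mat n" for y
      using z(2) cInf_lower[OF imageI[OF that] bd] by linarith
    then show ?thesis using z(1) by blast
  qed
  then obtain z where z: "\<And>n. z n \<in> Mat n"
    and zmin: "\<And>n y. y \<in> Mat n \<Longrightarrow> norm (X n - iota n (z n)) < norm (X n - iota n y) + 1 / Suc n"
    by metis
  have lim0: "(\<lambda>n. X n - iota n (z n)) \<longlonglongrightarrow> 0"
  proof (rule LIMSEQ_I)
    fix e :: real assume "0 < e"
    then have e: "0 < e / 3" by simp
    from CauchyD[OF X e] obtain K where K: "\<And>m n. K \<le> m \<Longrightarrow> K \<le> n \<Longrightarrow> norm (X m - X n) < e / 3"
      by blast
    obtain x where x: "uhf_cauchy x" "(\<lambda>n. iota n (x n)) \<longlonglongrightarrow> X K"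
      by (rule uhf_approx)
    from LIMSEQ_D[OF x(2) e] obtain N where N: "\<And>n. N \<le> n \<Longrightarrow> norm (iota n (x n) - X K) < e / 3"
      by blast
    obtain L where L: "1 / real (Suc L) < e / 3"
      using nat_approx_posE[OF e] by blast
    have "norm (X n - iota n (z n) - 0) < e" if n: "max K (max N L) \<le> n" for n
    proof -
      have "norm (X n - iota n (x n)) \<le> norm (X n - X K) + norm (X K - iota n (x n))"
        using norm_triangle_ineq[of "X n - X K" "X K - iota n (x n)"] by simp
      also have "\<dots> < e / 3 + e / 3"
        using K[of n K] N[of n] n by (intro add_strict_mono) (auto simp: norm_minus_commute)
      finally have "norm (X n - iota n (x n)) < e / 3 + e / 3" .
      moreover have "1 / real (Suc n) \<le> 1 / real (Suc L)"
        using n by (simp add: frac_le)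
      ultimately show ?thesis
        using zmin[OF uhf_cauchy_Mat[OF x(1)], of n] L by simp
    qed
    then show "\<exists>N. \<forall>n\<ge>N. norm (X n - iota n (z n) - 0) < e" by blast
  qed
  have Z: "\<exists>N. \<forall>m\<ge>N. \<forall>n\<ge>N. norm (iota m (z m) - iota n (z n)) < e" if "0 < e" for e
  proof -
    have e: "0 < e / 3" using that by simp
    from CauchyD[OF X e] obtain K where K: "\<And>m n. K \<le> m \<Longrightarrow> K \<le> n \<Longrightarrow> norm (X m - X n) < e / 3"
      by blast
    from LIMSEQ_D[OF lim0 e] obtain N where N: "\<And>n. N \<le> n \<Longrightarrow> norm (X n - iota n (z n)) < e / 3"
      by auto
    have "norm (iota m (z m) - iota n (z n)) < e" if "max K N \<le> m" "max K N \<le> n" for m n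
    proof -
      have "iota m (z m) - iota n (z n)
          = (X m - X n) + ((X n - iota n (z n)) - (X m - iota m (z m)))"
        by simp
      then have "norm (iota m (z m) - iota n (z n))
          \<le> norm (X m - X n) + (norm (X n - iota n (z n)) + norm (X m - iota m (z m)))"
        using norm_triangle_mono[OF order_refl norm_triangle_ineq4] by metis
      then show ?thesis
        using K[of m n] N[of m] N[of n] that by simp
    qed
    then show ?thesis by blast
  qed
  have "uhf_cauchy z"
  proof (rule uhf_cauchyI)
    fix e :: real assume "0 < e"
    from Z[OF this] obtain N
      where N: "\<And>m n. N \<le> m \<Longrightarrow> N \<le> n \<Longrightarrow> norm (iota m (z m) - iota n (z n)) < e" by blast
    have "opnorm n (z n - emb m n (z m)) < e" if "N \<le> m" "m \<le> n" for m n
    proof -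
      have "opnorm n (z n - emb m n (z m)) = norm (iota n (z n) - iota m (z m))"
        using that z by (simp add: norm_iota[symmetric] Mat_diff Mat_emb iota_diff iota_emb)
      then show ?thesis
        using N[of n m] that by simp
    qed
    then show "\<exists>N. \<forall>m\<ge>N. \<forall>n\<ge>m. opnorm n (z n - emb m n (z m)) < e" by blast
  qed (rule z)
  from tendsto_add[OF lim0 iota_tendsto[OF this]] show "convergent X"
    by (auto simp: convergent_def)
qed

section \<open>The slice maps\<close>

text \<open>\<open>slice k n y\<close> applies the state $x\mapsto x_{22}$ to the last $n-k$ tensor factors of a matrix
  of level $n\ge k$.\<close>

definition slice :: "nat \<Rightarrow> nat \<Rightarrow> mat \<Rightarrow> mat" where
  "slice k n y = (\<lambda>u v. y (u @ replicate (n - k) 2) (v @ replicate (n - k) 2))"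

lemma slice_diff: "slice k n (x - y) u v = slice k n x u v - slice k n y u v"
  by (simp add: slice_def)

lemma slice_bound:
  assumes "y \<in> Mat n"
  shows "cmod (slice k n y u v) \<le> opnorm n y"
proof (cases "u @ replicate (n - k) 2 \<in> words n \<and> v @ replicate (n - k) 2 \<in> words n")
  case True
  then show ?thesis by (simp add: slice_def opnorm_entry)
next
  case False
  then have "slice k n y u v = 0"
    unfolding slice_def by (intro Mat_D[OF assms]) blast
  then show ?thesis by simp
qed

lemma Mat_slice:
  assumes "y \<in> Mat n" "k \<le> n"
  shows "slice k n y \<in> Mat k"
proof -
  have "w @ replicate (n - k) 2 \<in> words n \<longleftrightarrow> w \<in> words k" for w
    using assms(2) by (auto simp: words_def)
  then show ?thesis
    using assms(1) unfolding Mat_iff slice_def by blast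
qed

lemma slice_emb:
  assumes "y \<in> Mat m" "k \<le> m" "m \<le> n"
  shows "slice k n (emb m n y) = slice k m y"
proof (intro ext)
  fix u v
  have kn: "k \<le> n" using assms by simp
  show "slice k n (emb m n y) u v = slice k m y u v"
  proof (cases "u \<in> words k \<and> v \<in> words k")
    case True
    have "n - k = (m - k) + (n - m)" using assms by simp
    then have r: "replicate (n - k) (2::3) = replicate (m - k) 2 @ replicate (n - m) 2"
      by (simp only: replicate_add)
    show ?thesis
      using True assms unfolding slice_def r append_assoc[symmetric]
      by (subst emb_append) (auto simp: words_def ident_def)
  next
    case False
    then show ?thesis
      using Mat_D[OF Mat_slice[OF Mat_emb[OF assms(1,3)] kn], of u v]
        Mat_D[OF Mat_slice[OF assms(1,2)], of u v] by auto
  qed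
qed

lemma slice_tendsto:
  assumes "uhf_cauchy x"
  shows "(\<lambda>n. slice k n (x n) u v) \<longlonglongrightarrow> lim (\<lambda>n. slice k n (x n) u v)"
proof -
  have "Cauchy (\<lambda>n. slice k n (x n) u v)"
  proof (rule CauchyI')
    fix e :: real assume "0 < e"
    from uhf_cauchyD[OF assms this] obtain N
      where N: "\<And>m n. N \<le> m \<Longrightarrow> m \<le> n \<Longrightarrow> opnorm n (x n - emb m n (x m)) < e" by blast
    have "dist (slice k m (x m) u v) (slice k n (x n) u v) < e" if "max N k \<le> m" "m < n" for m n
    proof -
      have "dist (slice k m (x m) u v) (slice k n (x n) u v)
          = cmod (slice k n (x n - emb m n (x m)) u v)"
        using that assms
        by (simp add: slice_diff slice_emb uhf_cauchy_Mat dist_norm norm_minus_commute)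
      also have "\<dots> \<le> opnorm n (x n - emb m n (x m))"
        using that assms by (intro slice_bound Mat_diff Mat_emb uhf_cauchy_Mat) auto
      also have "\<dots> < e"
        using N[of m n] that by simp
      finally show ?thesis .
    qed
    then show "\<exists>M. \<forall>m\<ge>M. \<forall>n>m. dist (slice k m (x m) u v) (slice k n (x n) u v) < e"
      by blast
  qed
  then show ?thesis
    by (simp add: Cauchy_convergent_iff convergent_LIMSEQ_iff)
qed

text \<open>\<open>rho m\<close> keeps the first $m+1$ tensor factors.  It is the continuous extension of the slice
  maps from the dense union of the finite levels.\<close>

lift_definition rho :: "nat \<Rightarrow> uhf \<Rightarrow> mat" is
  "\<lambda>m x u v. lim (\<lambda>n. slice (m + 1) n (x n) u v)"
proof (intro ext)
  fix m u v and x y assume xy: "uhf_rel x y"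
  have d: "(\<lambda>n. opnorm n (x n - y n)) \<longlonglongrightarrow> 0" and x: "uhf_cauchy x" and y: "uhf_cauchy y"
    using xy by (auto simp: uhf_rel_def)
  have "(\<lambda>n. slice (m + 1) n (x n) u v - slice (m + 1) n (y n) u v) \<longlonglongrightarrow> 0"
    by (rule Lim_null_comparison[OF _ d])
       (use x y in \<open>simp add: slice_bound Mat_diff uhf_cauchy_Mat flip: slice_diff\<close>)
  moreover have "(\<lambda>n. slice (m + 1) n (x n) u v - slice (m + 1) n (y n) u v)
      \<longlonglongrightarrow> lim (\<lambda>n. slice (m + 1) n (x n) u v) - lim (\<lambda>n. slice (m + 1) n (y n) u v)"
    by (intro tendsto_diff slice_tendsto x y)
  ultimately show "lim (\<lambda>n. slice (m + 1) n (x n) u v) = lim (\<lambda>n. slice (m + 1) n (y n) u v)"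
    using LIMSEQ_unique by fastforce
qed

lemma rho_iota:
  assumes "y \<in> Mat n" "m + 1 \<le> n"
  shows "rho m (iota n y) = slice (m + 1) n y"
proof (transfer fixing: m n y, intro ext)
  fix u v
  show "lim (\<lambda>k. slice (m + 1) k (if y \<in> Mat n \<and> n \<le> k then emb n k y else 0) u v)
      = slice (m + 1) n y u v"
    by (rule limI, rule tendsto_eventually, rule eventually_sequentiallyI[of n])
       (use assms in \<open>simp add: slice_emb\<close>)
qed

lemma rho_add: "rho m (x + y) = rho m x + rho m y"
proof (transfer fixing: m, unfold uhf_rel_refl_iff, intro ext)
  fix x y u v assume "uhf_cauchy x" "uhf_cauchy y"
  then have "(\<lambda>n. slice (m + 1) n (x n) u v + slice (m + 1) n (y n) u v)
      \<longlonglongrightarrow> lim (\<lambda>n. slice (m + 1) n (x n) u v) + lim (\<lambda>n. slice (m + 1) n (y n) u v)"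
    by (intro tendsto_add slice_tendsto)
  then show "lim (\<lambda>n. slice (m + 1) n (x n + y n) u v)
      = ((\<lambda>u v. lim (\<lambda>n. slice (m + 1) n (x n) u v)) + (\<lambda>u v. lim (\<lambda>n. slice (m + 1) n (y n) u v))) u v"
    by (simp add: slice_def limI)
qed

lemma rho_uscale: "rho m (uscale c x) = mscale c (rho m x)"
proof (transfer fixing: m c, unfold uhf_rel_refl_iff, intro ext)
  fix x u v assume "uhf_cauchy x"
  then have "(\<lambda>n. c * slice (m + 1) n (x n) u v) \<longlonglongrightarrow> c * lim (\<lambda>n. slice (m + 1) n (x n) u v)"
    by (intro tendsto_mult_left slice_tendsto)
  then show "lim (\<lambda>n. slice (m + 1) n (mscale c (x n)) u v)
      = mscale c (\<lambda>u v. lim (\<lambda>n. slice (m + 1) n (x n) u v)) u v"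
    by (simp add: slice_def mscale_def limI)
qed

lemma rho_diff: "rho m (x - y) = rho m x - rho m y"
  using rho_add[of m "x - y" y] by (simp add: algebra_simps)

lemma cmod_rho_le: "cmod (rho m x u v) \<le> norm x"
proof (transfer fixing: m u v, unfold uhf_rel_refl_iff)
  fix x assume x: "uhf_cauchy x"
  show "cmod (lim (\<lambda>n. slice (m + 1) n (x n) u v)) \<le> lim (\<lambda>n. opnorm n (x n))"
    by (rule LIMSEQ_le[OF tendsto_norm[OF slice_tendsto[OF x]] uhf_cauchy_norm_convergent[OF x]])
       (use x in \<open>auto simp: slice_bound uhf_cauchy_Mat\<close>)
qed

lemma Mat_rho: "rho m x \<in> Mat (m + 1)"
proof (transfer fixing: m, unfold uhf_rel_refl_iff)
  fix x assume x: "uhf_cauchy x"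
  show "(\<lambda>u v. lim (\<lambda>n. slice (m + 1) n (x n) u v)) \<in> Mat (m + 1)"
    unfolding Mat_iff
  proof (intro allI impI)
    fix u v assume uv: "u \<notin> words (m + 1) \<or> v \<notin> words (m + 1)"
    show "lim (\<lambda>n. slice (m + 1) n (x n) u v) = 0"
      by (rule limI, rule tendsto_eventually, rule eventually_sequentiallyI[of "m + 1"])
         (rule Mat_D[OF Mat_slice[OF uhf_cauchy_Mat[OF x]] uv])
  qed
qed

section \<open>The algebras $\mathcal A_n$ and $\mathcal A_\infty$\<close>

definition munit :: "3 \<Rightarrow> 3 \<Rightarrow> mat" where
  "munit i j = (\<lambda>u v. if u = [i] \<and> v = [j] then 1 else 0)"

primrec tensor_pow :: "mat \<Rightarrow> nat \<Rightarrow> mat" where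
  "tensor_pow x 0 = ident 0"
| "tensor_pow x (Suc n) = tensor 1 x (tensor_pow x n)"

definition alpha :: "nat \<Rightarrow> 3 \<Rightarrow> mat" where
  "alpha n j = tensor 1 (munit j j) (tensor_pow (munit 2 2) n)"

definition beta :: "nat \<Rightarrow> 3 \<Rightarrow> mat" where
  "beta k j = tensor 2
     (tensor 1 (munit j j) (munit 1 1) + tensor 1 (munit (j + 2) (j + 2)) (munit 3 3))
     (tensor_pow (munit 2 2) (k - 1))"

definition A_fin :: "nat \<Rightarrow> mat set" where
  "A_fin n = mat.span (range (alpha n) \<union>
     {tensor (n - k) x (beta k j) | k j x. 1 \<le> k \<and> k \<le> n \<and> x \<in> Mat (n - k)})"

text \<open>Elements of \<open>A_fin n\<close> are matrices of level \<open>n + 1\<close>.\<close>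

definition A_inf :: "uhf set" where
  "A_inf = {b. \<exists>a. (\<forall>n. a n \<in> A_fin n) \<and> (\<lambda>n. iota (n + 1) (a n)) \<longlonglongrightarrow> b}"

section \<open>Energy forms\<close>

text \<open>\<open>component b i\<close> is $b(v_i)$, the $(i,i)$ block of $b$ with respect to the last tensor factor.\<close>

definition component :: "mat \<Rightarrow> 3 \<Rightarrow> mat" where
  "component b i = (\<lambda>u v. b (u @ [i]) (v @ [i]))"

definition abs_sq :: "nat \<Rightarrow> mat \<Rightarrow> mat" where
  "abs_sq n x = mmult n (adj x) x"

text \<open>The traces are nonnegative real numbers, see \<open>tr_abs_sq\<close>; \<open>Re\<close> only changes the type.\<close>

definition energy :: "nat \<Rightarrow> mat \<Rightarrow> real" where
  "energy n b = (\<Sum>(i, j)\<in>{(i, j). i \<noteq> j}. Re (tr n (abs_sq n (component b i - component b j))))"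

definition energy_inf :: "uhf \<Rightarrow> ennreal" where
  "energy_inf b = lim (\<lambda>m. ennreal ((5 / 3) ^ m * energy m (rho m b)))"

definition energy_dom :: "uhf set" where
  "energy_dom = {b \<in> A_inf. energy_inf b < \<infinity>}"

lemma tr_abs_sq:
  "tr n (abs_sq n x) = complex_of_real (\<Sum>u\<in>words n. \<Sum>w\<in>words n. (cmod (x w u))\<^sup>2)"
  unfolding tr_def abs_sq_def mmult_def adj_def of_real_sum
  by (simp add: complex_norm_square mult.commute flip: of_real_power)

lemma energy_nonneg: "0 \<le> energy n b"
  unfolding energy_def by (intro sum_nonneg) (auto simp: tr_abs_sq sum_nonneg)

text \<open>A quadratic form on the complex space \<open>V\<close> with values in $[0,\infty]$: it is finite on a
  linear subspace, where it is the diagonal of a sesquilinear form (conjugate-linear in the first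
  argument).\<close>

definition sesquilinear_on :: "uhf set \<Rightarrow> (uhf \<Rightarrow> uhf \<Rightarrow> complex) \<Rightarrow> bool" where
  "sesquilinear_on D s \<longleftrightarrow>
     (\<forall>a\<in>D. \<forall>b\<in>D. \<forall>b'\<in>D. s a (b + b') = s a b + s a b' \<and> s (b + b') a = s b a + s b' a) \<and>
     (\<forall>a\<in>D. \<forall>b\<in>D. \<forall>c. s a (uscale c b) = c * s a b \<and> s (uscale c a) b = cnj c * s a b)"

definition quadratic_form_on :: "uhf set \<Rightarrow> (uhf \<Rightarrow> ennreal) \<Rightarrow> bool" where
  "quadratic_form_on V q \<longleftrightarrow> uhf.subspace V \<and> uhf.subspace {b \<in> V. q b < \<infinity>} \<and>
     (\<exists>s. sesquilinear_on {b \<in> V. q b < \<infinity>} s \<and>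
       (\<forall>b\<in>V. q b < \<infinity> \<longrightarrow> s b b = complex_of_real (enn2real (q b))))"

definition form_norm :: "uhf \<Rightarrow> real" where
  "form_norm b = sqrt ((norm b)\<^sup>2 + enn2real (energy_inf b))"

definition norm_on :: "uhf set \<Rightarrow> (uhf \<Rightarrow> real) \<Rightarrow> bool" where
  "norm_on D N \<longleftrightarrow> uhf.subspace D \<and>
     (\<forall>a\<in>D. 0 \<le> N a \<and> (N a = 0 \<longleftrightarrow> a = 0)) \<and>
     (\<forall>a\<in>D. \<forall>c. N (uscale c a) = cmod c * N a) \<and>
     (\<forall>a\<in>D. \<forall>b\<in>D. N (a + b) \<le> N a + N b)"

text \<open>\<open>norm_on\<close> makes the function \<open>\<lambda>a b. N (a - b)\<close> a metric on \<open>D\<close>, in which completeness is meant.\<close>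

definition complete_for_norm :: "uhf set \<Rightarrow> (uhf \<Rightarrow> real) \<Rightarrow> bool" where
  "complete_for_norm D N \<longleftrightarrow> norm_on D N \<and> Metric_space.mcomplete D (\<lambda>a b. N (a - b))"

end

theory Submission
  imports Defs
begin

text \<open>
  Passing from level \<open>m\<close> to level \<open>m + 1\<close> keeps the corner values \<open>a 1, a 2, a 3\<close> of a triangle and
  adds three junction values \<open>x 1, x 2, x 3\<close>, as in the refinement of the Sierpinski gasket.  The
  energy is entrywise a sum over scalar triangles, so monotonicity is the gasket identity: the
  refined energy is \<open>3/5\<close> of the original one plus squares that vanish exactly when the junction
  values are the harmonic ones.  Harmonic extension therefore has constant renormalized energy, and
  it contracts the oscillation (in operator norm) by \<open>3/5\<close>, so that its iterates converge in norm to
  an element of finite energy; elements of \<open>A_fin n\<close> approximating a given element of \<open>A_inf\<close> have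
  oscillation tending to zero, which gives density.  Completeness holds because the limit energy is
  a supremum of forms that are continuous for the uniform norm.
\<close>

section \<open>Entries of the generators, and the linear constraints they impose on
  \<open>A_fin n\<close>\<close>

lemma munit_entry: "munit i j u v = of_bool (u = [i] \<and> v = [j])"
  by (simp add: munit_def)

lemma tensor_pow_munit:
  "tensor_pow (munit i i) n u v = of_bool (u = replicate n i \<and> v = replicate n i)"
proof (induction n arbitrary: u v)
  case 0
  then show ?case by (auto simp: ident_def words_def)
next
  case (Suc n)
  then show ?case by (cases u; cases v) (auto simp: tensor_def munit_entry)
qed

lemma alpha_entry: "alpha n j u v = of_bool (u = v \<and> u = j # replicate n 2)"
  by (cases u; cases v) (auto simp: alpha_def tensor_def munit_entry tensor_pow_munit)

lemma beta_entry:
  "beta k j u v = of_bool (u = v \<and>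
     (u = j # 1 # replicate (k - 1) 2 \<or> u = (j + 2) # 3 # replicate (k - 1) 2))"
proof -
  have *: "w = [] \<or> (\<exists>a. w = [a]) \<or> (\<exists>a b w'. w = a # b # w')" for w :: word3
    by (metis list.exhaust)
  show ?thesis
    using *[of u] *[of v]
    by (elim disjE exE) (auto simp: beta_def tensor_def munit_entry tensor_pow_munit)
qed

lemma A_fin_induct [consumes 1, case_names alpha beta zero add scale]:
  assumes "a \<in> A_fin n"
    and "\<And>j. P (alpha n j)"
    and "\<And>k j x. 1 \<le> k \<Longrightarrow> k \<le> n \<Longrightarrow> x \<in> Mat (n - k) \<Longrightarrow> P (tensor (n - k) x (beta k j))"
    and "P 0" "\<And>x y. P x \<Longrightarrow> P y \<Longrightarrow> P (x + y)" "\<And>c x. P x \<Longrightarrow> P (mscale c x)"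
  shows "P a"
  using assms(1) unfolding A_fin_def
proof (rule mat.span_induct)
  show "mat.subspace (Collect P)"
    using assms(4-6) by (auto simp: mat.subspace_def)
qed (use assms(2,3) in auto)

lemma Mat_A_fin: "a \<in> A_fin n \<Longrightarrow> a \<in> Mat (n + 1)"
proof (induction rule: A_fin_induct)
  case (alpha j)
  then show ?case by (auto simp: Mat_iff alpha_entry words_def)
next
  case (beta k j x)
  have "Defs.beta k j \<in> Mat (k + 1)"
    using beta by (auto simp: Mat_iff beta_entry words_def)
  from Mat_tensor[OF beta(3) this] show ?case
    using beta by simp
qed (rule Mat_zero Mat_add Mat_scale; assumption?)+

text \<open>This is the inclusion of \<open>A_fin n\<close> in the tensor product of level
  \<open>n\<close> with the diagonal algebra: both kinds of generators are diagonal in their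
  trailing letters.\<close>

lemma A_fin_diag:
  assumes "a \<in> A_fin n" "last u \<noteq> last v" "u \<in> words (n + 1)" "v \<in> words (n + 1)"
  shows "a u v = 0"
  using assms(1)
proof (induction rule: A_fin_induct)
  case (alpha j)
  then show ?case using assms by (auto simp: alpha_entry)
next
  case (beta k j x)
  \<comment> \<open>The tails have length \<open>k + 1\<close>, so they contain the last
    letter.\<close>
  have "drop (n - k) u \<noteq> drop (n - k) v"
    using assms(2-4) by (auto simp: words_def dest!: arg_cong[where f = last])
  then show ?case by (simp add: tensor_def beta_entry)
qed (auto simp: mscale_def)

lemma nth_pattern:
  assumes "t \<le> r"
  shows "(u @ [i, c] @ replicate r x) ! (length u + 1 + t) = (if t = 0 then c else x)"
  using assms by (cases t) (simp_all add: nth_append)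

text \<open>The matrix analogue of two small triangles sharing a vertex. Both words carry a letter
  other than 2 at position \<open>m + 1\<close>, followed only by 2s. Among the generators only
  those with \<open>k = r + 1\<close> can be nonzero there, and \<open>beta k j\<close> takes the
  same value on the two tails.\<close>

lemma A_fin_glue:
  assumes "a \<in> A_fin n" "length u = m" "length v = m" "n = m + 1 + r"
  shows "a (u @ [i, 1] @ replicate r 2) (v @ [i, 1] @ replicate r 2)
    = a (u @ [i + 2, 3] @ replicate r 2) (v @ [i + 2, 3] @ replicate r 2)"
  using assms(1)
proof (induction rule: A_fin_induct)
  case (alpha j)
  \<comment> \<open>The support of \<open>alpha n j\<close> has only 2s after its first letter,
    whereas position \<open>m + 1\<close> is a later one.\<close>
  have "u @ [i', c] @ replicate r 2 \<noteq> j # replicate n 2" if "c \<noteq> 2" for i' c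
  proof
    assume eq: "u @ [i', c] @ replicate r 2 = j # replicate n 2"
    have "(u @ [i', c] @ replicate r 2) ! (m + 1) = c"
      using nth_pattern[of 0 r u i' c] assms(2) by simp
    moreover have "m < n" using assms(4) by simp
    then have "(j # replicate n 2) ! (m + 1) = 2" by simp
    ultimately show False using eq that by simp
  qed
  then show ?case by (simp add: alpha_entry)
next
  case (beta k j x)
  show ?case
  proof (cases "k = r + 1")
    case True
    then have "n - k = m" using assms by simp
    then show ?thesis
      using True assms by (simp add: tensor_def beta_entry)
  next
    case False
    have "Defs.beta k j (drop (n - k) (u @ [i', c] @ replicate r 2)) w = 0" if c: "c \<noteq> 2" for i' c w
    proof (rule ccontr)
      let ?w = "drop (n - k) (u @ [i', c] @ replicate r 2)"
      assume "Defs.beta k j ?w w \<noteq> 0"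
      then have eq: "\<exists>p q. q \<noteq> 2 \<and> ?w = p # q # replicate (k - 1) 2"
        by (auto simp: beta_entry)
      have nth: "?w ! t = (u @ [i', c] @ replicate r 2) ! (n - k + t)" if "t \<le> k" for t
        using assms that beta by (subst nth_drop) auto
      show False
      \<comment> \<open>If the tail is short, its second letter already lies in the final block of
        2s, but \<open>beta\<close> wants 1 or 3 there. If it is long, \<open>c\<close> sits at
        position \<open>k - r\<close>, at least 2, where \<open>beta\<close> wants a 2.\<close>
      proof (cases "k < r + 1")
        case True
        have "n - k + 1 = length u + 1 + (r + 1 - k)"
          using True assms beta by simp
        then have "?w ! 1 = 2"
          using nth[OF beta(1)] nth_pattern[of "r + 1 - k" r u i' c] True beta(1) by simp
        then show False using eq by auto
      next
        case f: False
        have "n - k + (k - r) = length u + 1 + 0"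
          using assms False f beta by simp
        then have "?w ! (k - r) = c"
          using nth[of "k - r"] nth_pattern[of 0 r u i' c] by simp
        moreover obtain s where "k - r = Suc (Suc s)" "s < k - 1"
          using False f by (intro that[of "k - r - 2"]) auto
        then have "?w ! (k - r) = 2"
          using eq by auto
        ultimately show False using c by simp
      qed
    qed
    then show ?thesis by (simp add: tensor_def)
  qed
qed (auto simp: mscale_def)

section \<open>Triangle energies\<close>

definition tri :: "(3 \<Rightarrow> complex) \<Rightarrow> real" where
  "tri f = (\<Sum>(i, j)\<in>{(i, j). i \<noteq> j}. (cmod (f i - f j))\<^sup>2)"

text \<open>\<open>cell a x p\<close> is the small triangle \<open>p\<close>; the junction value \<open>x p\<close> is shared by the triangles
  \<open>p\<close> and \<open>p + 2\<close> since \<open>beta k p\<close> lives on the words starting with \<open>[p, 1]\<close> and \<open>[p + 2, 3]\<close>.\<close>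

definition cell :: "(3 \<Rightarrow> 'a) \<Rightarrow> (3 \<Rightarrow> 'a) \<Rightarrow> 3 \<Rightarrow> 3 \<Rightarrow> 'a" where
  "cell a x p q = (if q = 2 then a p else if q = 1 then x p else x (p + 1))"

text \<open>The 2/5-2/5-1/5 rule of the Sierpinski gasket: junction \<open>j\<close> lies between
  the corners \<open>j\<close> and \<open>j + 2\<close>, and \<open>j + 1\<close> is the opposite
  corner.\<close>

definition harm :: "(3 \<Rightarrow> complex) \<Rightarrow> 3 \<Rightarrow> complex" where
  "harm a j = (2 * a j + 2 * a (j + 2) + a (j + 1)) / 5"

lemma three_add: "(1::3) + 1 = 2" "(2::3) + 1 = 3" "(3::3) + 1 = 1"
  "(1::3) + 2 = 3" "(2::3) + 2 = 1" "(3::3) + 2 = 2"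
  by simp_all

lemma tri_expand: "tri f = 2 * ((cmod (f 1 - f 2))\<^sup>2 + (cmod (f 2 - f 3))\<^sup>2 + (cmod (f 1 - f 3))\<^sup>2)"
proof -
  have "tri f = (\<Sum>(i, j)\<in>UNIV \<times> UNIV. (cmod (f i - f j))\<^sup>2)"
    unfolding tri_def by (rule sum.mono_neutral_left) auto
  also have "\<dots> = (\<Sum>i\<in>UNIV. \<Sum>j\<in>UNIV. (cmod (f i - f j))\<^sup>2)"
    by (simp add: sum.cartesian_product)
  finally show ?thesis
    by (simp only: sum_3) (simp add: norm_minus_commute)
qed

lemma tri_nonneg: "0 \<le> tri f"
  by (simp add: tri_expand)

text \<open>Completion of the square around the harmonic junction values; \<open>u\<close>,
  \<open>v\<close>, \<open>w\<close> are the deviations from them.\<close>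

lemma gasket_identity_real:
  fixes a b c u v w x y z :: real
  assumes "x = u + (2 * a + 2 * c + b) / 5" "y = v + (2 * b + 2 * a + c) / 5"
    "z = w + (2 * c + 2 * b + a) / 5"
  shows "((x - a)\<^sup>2 + (a - y)\<^sup>2 + (x - y)\<^sup>2) + ((y - b)\<^sup>2 + (b - z)\<^sup>2 + (y - z)\<^sup>2)
      + ((z - c)\<^sup>2 + (c - x)\<^sup>2 + (z - x)\<^sup>2)
    = 3 / 5 * ((a - b)\<^sup>2 + (b - c)\<^sup>2 + (a - c)\<^sup>2) + 2 * (u\<^sup>2 + v\<^sup>2 + w\<^sup>2)
      + ((u - v)\<^sup>2 + (v - w)\<^sup>2 + (u - w)\<^sup>2)"
proof -
  \<comment> \<open>Measuring the corners in units of 5 clears the denominators and leaves a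
    polynomial identity with integer coefficients.\<close>
  define a' b' c' where "a' = a / 5" "b' = b / 5" "c' = c / 5"
  then have "a = 5 * a'" "b = 5 * b'" "c = 5 * c'"
    by auto
  then have "x = u + 2 * a' + 2 * c' + b'" "y = v + 2 * b' + 2 * a' + c'" "z = w + 2 * c' + 2 * b' + a'"
    using assms by auto
  then have "((x - 5 * a')\<^sup>2 + (5 * a' - y)\<^sup>2 + (x - y)\<^sup>2)
      + ((y - 5 * b')\<^sup>2 + (5 * b' - z)\<^sup>2 + (y - z)\<^sup>2)
      + ((z - 5 * c')\<^sup>2 + (5 * c' - x)\<^sup>2 + (z - x)\<^sup>2)
    = 15 * ((a' - b')\<^sup>2 + (b' - c')\<^sup>2 + (a' - c')\<^sup>2) + 2 * (u\<^sup>2 + v\<^sup>2 + w\<^sup>2)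
      + ((u - v)\<^sup>2 + (v - w)\<^sup>2 + (u - w)\<^sup>2)"
    by algebra
  moreover have "15 * ((a' - b')\<^sup>2 + (b' - c')\<^sup>2 + (a' - c')\<^sup>2)
      = 3 / 5 * ((5 * a' - 5 * b')\<^sup>2 + (5 * b' - 5 * c')\<^sup>2 + (5 * a' - 5 * c')\<^sup>2)"
    by (simp only: right_diff_distrib[symmetric] power_mult_distrib) (simp add: algebra_simps)
  ultimately show ?thesis
    using \<open>a = _\<close> \<open>b = _\<close> \<open>c = _\<close> by simp
qed

text \<open>Used in two ways: dropping the squares gives monotonicity, and inserting
  \<open>x = harm a\<close> makes them vanish. Real and imaginary parts are treated
  separately.\<close>

lemma gasket_identity:
  "(\<Sum>p\<in>UNIV. tri (cell a x p))
    = 3 / 5 * tri a + 4 * (\<Sum>j\<in>UNIV. (cmod (x j - harm a j))\<^sup>2) + tri (\<lambda>j. x j - harm a j)"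
proof -
  define w where "w = (\<lambda>j. x j - harm a j)"
  have x: "x 1 = w 1 + (2 * a 1 + 2 * a 3 + a 2) / 5" "x 2 = w 2 + (2 * a 2 + 2 * a 1 + a 3) / 5"
    "x 3 = w 3 + (2 * a 3 + 2 * a 2 + a 1) / 5"
    by (simp_all only: w_def harm_def three_add) simp_all
  have cell: "cell a x 1 1 = x 1" "cell a x 1 2 = a 1" "cell a x 1 3 = x 2"
    "cell a x 2 1 = x 2" "cell a x 2 2 = a 2" "cell a x 2 3 = x 3"
    "cell a x 3 1 = x 3" "cell a x 3 2 = a 3" "cell a x 3 3 = x 1"
    unfolding cell_def three_add by simp_all
  have "Re (x 1) = Re (w 1) + (2 * Re (a 1) + 2 * Re (a 3) + Re (a 2)) / 5"
    "Re (x 2) = Re (w 2) + (2 * Re (a 2) + 2 * Re (a 1) + Re (a 3)) / 5"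
    "Re (x 3) = Re (w 3) + (2 * Re (a 3) + 2 * Re (a 2) + Re (a 1)) / 5"
    by (simp_all add: x)
  note re = gasket_identity_real[OF this]
  have "Im (x 1) = Im (w 1) + (2 * Im (a 1) + 2 * Im (a 3) + Im (a 2)) / 5"
    "Im (x 2) = Im (w 2) + (2 * Im (a 2) + 2 * Im (a 1) + Im (a 3)) / 5"
    "Im (x 3) = Im (w 3) + (2 * Im (a 3) + 2 * Im (a 2) + Im (a 1)) / 5"
    by (simp_all add: x)
  note im = gasket_identity_real[OF this]
  have w: "x j - harm a j = w j" for j
    by (simp add: w_def)
  show ?thesis
    unfolding sum_3 tri_expand cell cmod_power2 w minus_complex.sel using re im by argo
qed

lemma sum_words_Suc: "(\<Sum>u\<in>words (Suc n). f u) = (\<Sum>u\<in>words n. \<Sum>p\<in>UNIV. f (u @ [p]))"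
proof -
  have "words 1 = (\<lambda>p. [p]) ` UNIV"
    by (auto simp: words_def length_Suc_conv)
  then have "(\<Sum>w\<in>words 1. g w) = (\<Sum>p\<in>UNIV. g [p])" for g :: "word3 \<Rightarrow> 'a"
    by (simp add: sum.reindex inj_on_def)
  then show ?thesis
    by (simp add: sum_words_split[of n "Suc n"] sum.swap[of _ UNIV])
qed

text \<open>The trace of \<open>abs_sq\<close> is the squared Hilbert-Schmidt norm, hence the energy
  decouples over the matrix entries into scalar triangles.\<close>

lemma energy_tri:
  "energy n b = (\<Sum>u\<in>words n. \<Sum>w\<in>words n. tri (\<lambda>i. b (w @ [i]) (u @ [i])))"
proof -
  have "(\<Sum>p\<in>S. \<Sum>u\<in>words n. \<Sum>w\<in>words n. g p u w)
      = (\<Sum>u\<in>words n. \<Sum>w\<in>words n. \<Sum>p\<in>S. g p u w)" for S :: "(3 \<times> 3) set" and g :: "_ \<Rightarrow> _ \<Rightarrow> _ \<Rightarrow> real"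
    by (subst sum.swap) (intro sum.cong refl sum.swap)
  then show ?thesis
    unfolding energy_def tri_def tr_abs_sq component_def Re_complex_of_real case_prod_beta
    by simp
qed

lemma energy_Suc:
  "energy (Suc n) b = (\<Sum>u\<in>words n. \<Sum>w\<in>words n. \<Sum>p\<in>UNIV. \<Sum>p'\<in>UNIV.
     tri (\<lambda>i. b (w @ [p', i]) (u @ [p, i])))"
  unfolding energy_tri sum_words_Suc
  by (rule sum.cong[OF refl], subst sum.swap) simp

text \<open>For fixed outer words, the hypothesis \<open>glue\<close> lets the nine block-diagonal
  values be read as three cells with shared junctions, to which the gasket identity applies.\<close>

lemma energy_slice_le:
  assumes glue: "\<And>u w i. u \<in> words n \<Longrightarrow> w \<in> words n \<Longrightarrow>
      b (w @ [i, 1]) (u @ [i, 1]) = b (w @ [i + 2, 3]) (u @ [i + 2, 3])"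
  shows "energy n (\<lambda>u v. b (u @ [2]) (v @ [2])) \<le> 5 / 3 * energy (Suc n) b"
proof -
  define cells where "cells = (\<lambda>u w. \<Sum>p\<in>UNIV. \<Sum>p'\<in>UNIV. tri (\<lambda>i. b (w @ [p', i]) (u @ [p, i])))"
  have "tri (\<lambda>i. b (w @ [i, 2]) (u @ [i, 2])) \<le> 5 / 3 * cells u w"
    if uw: "u \<in> words n" "w \<in> words n" for u w
  proof -
    define a x where "a = (\<lambda>p. b (w @ [p, 2]) (u @ [p, 2]))" and "x = (\<lambda>p. b (w @ [p, 1]) (u @ [p, 1]))"
    have three: "q = 1 \<or> q = 2 \<or> q = 3" for q :: 3
      by (rule exhaust_3)
    have shift: "p + 1 + 2 = p" for p :: 3
      using three[of p] by auto
    \<comment> \<open>The junction \<open>x (p + 1)\<close> is defined through the triangle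
      \<open>p + 1\<close>; \<open>glue\<close> moves it to the vertex 3 of the triangle
      \<open>p + 1 + 2 = p\<close>.\<close>
    have "cell a x p q = b (w @ [p, q]) (u @ [p, q])" for p q
      using three[of q] glue[OF uw, of "p + 1"] unfolding cell_def a_def x_def shift by auto
    then have c: "cell a x p = (\<lambda>q. b (w @ [p, q]) (u @ [p, q]))" for p
      by blast
    have "tri a \<le> 5 / 3 * (\<Sum>p\<in>UNIV. tri (cell a x p))"
      unfolding gasket_identity
      using tri_nonneg[of "\<lambda>j. x j - harm a j"] sum_nonneg[of UNIV "\<lambda>j. (cmod (x j - harm a j))\<^sup>2"] by simp
    \<comment> \<open>The blocks with \<open>p \<noteq> p'\<close> are not part of a cell; their
      energies are nonnegative and only increase the right-hand side.\<close>
    also have "\<dots> \<le> 5 / 3 * cells u w"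
      unfolding c cells_def by (intro mult_left_mono sum_mono member_le_sum) (auto simp: tri_nonneg)
    finally show ?thesis
      by (simp add: a_def)
  qed
  then have "(\<Sum>u\<in>words n. \<Sum>w\<in>words n. tri (\<lambda>i. b (w @ [i, 2]) (u @ [i, 2])))
      \<le> (\<Sum>u\<in>words n. \<Sum>w\<in>words n. 5 / 3 * cells u w)"
    by (intro sum_mono) auto
  then show ?thesis
    unfolding energy_Suc energy_tri[of n] by (simp add: cells_def sum_distrib_left)
qed

section \<open>Monotonicity of the renormalized energies\<close>

lemma rho_tendsto:
  assumes "X \<longlonglongrightarrow> b"
  shows "(\<lambda>n. rho m (X n) u v) \<longlonglongrightarrow> rho m b u v"
proof (rule LIM_zero_cancel, rule Lim_null_comparison)
  show "(\<lambda>n. norm (X n - b)) \<longlonglongrightarrow> 0"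
    using assms by (simp add: LIM_zero tendsto_norm_zero)
  show "\<forall>\<^sub>F n in sequentially. norm (rho m (X n) u v - rho m b u v) \<le> norm (X n - b)"
    using cmod_rho_le[of m "X _ - b" u v] by (simp add: rho_diff)
qed

text \<open>Reduces statements on \<open>rho\<close> of an abstract element to slices of finite
  matrices, whose identities then pass to the limit.\<close>

lemma slice_tendsto_rho:
  assumes "(\<lambda>n. iota (f n) (y n)) \<longlonglongrightarrow> b" "\<And>n. y n \<in> Mat (f n)"
    "eventually (\<lambda>n. m + 1 \<le> f n) sequentially"
  shows "(\<lambda>n. slice (m + 1) (f n) (y n) u v) \<longlonglongrightarrow> rho m b u v"
  by (rule Lim_transform_eventually[OF rho_tendsto[OF assms(1)]])
     (use assms(3) in eventually_elim, simp add: rho_iota assms(2))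

text \<open>Slicing down to \<open>m + 1\<close> factors appends one more 2 than slicing down to
  \<open>m + 2\<close> factors does.\<close>

lemma rho_eq_slice_rho_Suc: "rho m b = (\<lambda>u v. rho (Suc m) b (u @ [2]) (v @ [2]))"
proof (intro ext)
  fix u v
  obtain x where x: "uhf_cauchy x" "(\<lambda>n. iota n (x n)) \<longlonglongrightarrow> b"
    by (rule uhf_approx)
  note lim = slice_tendsto_rho[OF x(2) uhf_cauchy_Mat[OF x(1)] eventually_ge_at_top]
  have "slice (m + 1) n (x n) u v = slice (Suc m + 1) n (x n) (u @ [2]) (v @ [2])" if "m + 2 \<le> n" for n
  proof -
    have "replicate (n - (m + 1)) (2::3) = 2 # replicate (n - (Suc m + 1)) 2"
      using that by (simp add: Suc_diff_le flip: replicate_Suc)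
    then show ?thesis by (simp add: slice_def)
  qed
  then have "(\<lambda>n. slice (m + 1) n (x n) u v) \<longlonglongrightarrow> rho (Suc m) b (u @ [2]) (v @ [2])"
    by (intro Lim_transform_eventually[OF lim[of "Suc m"]] eventually_sequentiallyI[of "m + 2"]) simp
  then show "rho m b u v = rho (Suc m) b (u @ [2]) (v @ [2])"
    using lim[of m u v] LIMSEQ_unique by blast
qed

lemma A_inf_rho_glue:
  assumes "b \<in> A_inf" "u \<in> words m" "v \<in> words m"
  shows "rho (Suc m) b (u @ [i, 1]) (v @ [i, 1]) = rho (Suc m) b (u @ [i + 2, 3]) (v @ [i + 2, 3])"
proof -
  obtain a where a: "\<And>n. a n \<in> A_fin n" "(\<lambda>n. iota (n + 1) (a n)) \<longlonglongrightarrow> b"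
    using assms(1) by (auto simp: A_inf_def)
  have "eventually (\<lambda>n. Suc m + 1 \<le> n + 1) sequentially"
    by (rule eventually_sequentiallyI[of "Suc m"]) simp
  note lim = slice_tendsto_rho[OF a(2) Mat_A_fin[OF a(1)] this]
  have "slice (Suc m + 1) (n + 1) (a n) (u @ [i, 1]) (v @ [i, 1])
      = slice (Suc m + 1) (n + 1) (a n) (u @ [i + 2, 3]) (v @ [i + 2, 3])" if "Suc m \<le> n" for n
    using A_fin_glue[OF a(1), of u m v n "n + 1 - (Suc m + 1)" i] that assms
    by (simp add: slice_def words_def)
  then have "(\<lambda>n. slice (Suc m + 1) (n + 1) (a n) (u @ [i, 1]) (v @ [i, 1]))
      \<longlonglongrightarrow> rho (Suc m) b (u @ [i + 2, 3]) (v @ [i + 2, 3])"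
    by (intro Lim_transform_eventually[OF lim] eventually_sequentiallyI[of "Suc m"]) simp
  then show ?thesis
    using lim LIMSEQ_unique by blast
qed

section \<open>Renormalized energies and their limit\<close>

definition scaled_energy :: "uhf \<Rightarrow> nat \<Rightarrow> real" where
  "scaled_energy b m = (5 / 3) ^ m * energy m (rho m b)"

lemma scaled_energy_nonneg [simp]: "0 \<le> scaled_energy b m"
  by (simp add: scaled_energy_def energy_nonneg)

lemma incseq_scaled_energy:
  assumes "b \<in> A_inf"
  shows "incseq (scaled_energy b)"
proof (rule incseq_SucI)
  fix m
  have "energy m (rho m b) \<le> 5 / 3 * energy (Suc m) (rho (Suc m) b)"
    by (subst rho_eq_slice_rho_Suc, rule energy_slice_le) (rule A_inf_rho_glue[OF assms])
  then have "(5 / 3) ^ m * energy m (rho m b) \<le> (5 / 3) ^ m * (5 / 3 * energy (Suc m) (rho (Suc m) b))"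
    by (intro mult_left_mono) auto
  then show "scaled_energy b m \<le> scaled_energy b (Suc m)"
    by (simp add: scaled_energy_def mult_ac)
qed

text \<open>On \<open>A_inf\<close> the \<open>lim\<close> in \<open>energy_inf\<close> is a genuine
  limit: an increasing sequence in \<open>ennreal\<close> converges to its supremum.\<close>

lemma energy_inf_tendsto:
  assumes "b \<in> A_inf"
  shows "(\<lambda>m. ennreal (scaled_energy b m)) \<longlonglongrightarrow> energy_inf b"
proof -
  have "incseq (\<lambda>m. ennreal (scaled_energy b m))"
    using incseq_scaled_energy[OF assms] by (auto simp: incseq_def ennreal_leI)
  from LIMSEQ_SUP[OF this] show ?thesis
    unfolding energy_inf_def scaled_energy_def[symmetric] by (simp add: limI)
qed

lemma energy_inf_leI:
  assumes "b \<in> A_inf" "\<And>m. scaled_energy b m \<le> C"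
  shows "energy_inf b \<le> ennreal C"
  by (rule LIMSEQ_le_const2[OF energy_inf_tendsto[OF assms(1)]]) (auto simp: assms(2) ennreal_leI)

text \<open>Meaningful on \<open>energy_dom\<close> only: \<open>enn2real\<close> sends infinity to
  0.\<close>

definition real_energy :: "uhf \<Rightarrow> real" where
  "real_energy b = enn2real (energy_inf b)"

lemma energy_domI: "b \<in> A_inf \<Longrightarrow> (\<And>m. scaled_energy b m \<le> C) \<Longrightarrow> b \<in> energy_dom"
  using energy_inf_leI[of b C] by (auto simp: energy_dom_def intro: le_less_trans)

lemma energy_dom_A_inf: "b \<in> energy_dom \<Longrightarrow> b \<in> A_inf"
  by (simp add: energy_dom_def)

lemma real_energy_tendsto:
  assumes "b \<in> energy_dom"
  shows "scaled_energy b \<longlonglongrightarrow> real_energy b"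
proof -
  have "energy_inf b < \<infinity>"
    using assms by (simp add: energy_dom_def)
  then have "energy_inf b = ennreal (real_energy b)"
    by (simp add: real_energy_def)
  then have "(\<lambda>m. enn2real (ennreal (scaled_energy b m))) \<longlonglongrightarrow> real_energy b"
    using energy_inf_tendsto[OF energy_dom_A_inf[OF assms]]
    by (intro tendsto_enn2real) (simp_all add: real_energy_def)
  then show ?thesis
    by simp
qed

lemma scaled_energy_le: "b \<in> energy_dom \<Longrightarrow> scaled_energy b m \<le> real_energy b"
  using incseq_le[OF incseq_scaled_energy real_energy_tendsto] energy_dom_A_inf by blast

lemma real_energy_leI:
  assumes "b \<in> energy_dom" "\<And>m. scaled_energy b m \<le> C"
  shows "real_energy b \<le> C"
  by (rule LIMSEQ_le_const2[OF real_energy_tendsto[OF assms(1)]]) (use assms(2) in blast)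

section \<open>The limit form\<close>

text \<open>Collects all differences along edges into one vector, so that the energy is a squared l2
  norm and Minkowski's inequality applies.\<close>

definition edge_diff :: "mat \<Rightarrow> (3 \<times> 3) \<times> word3 \<times> word3 \<Rightarrow> complex" where
  "edge_diff b = (\<lambda>((i, j), u, w). b (w @ [i]) (u @ [i]) - b (w @ [j]) (u @ [j]))"

definition edges :: "nat \<Rightarrow> ((3 \<times> 3) \<times> word3 \<times> word3) set" where
  "edges n = {(i, j). i \<noteq> j} \<times> words n \<times> words n"

lemma edge_diff_add: "edge_diff (a + b) t = edge_diff a t + edge_diff b t"
  by (simp add: edge_diff_def case_prod_beta)

lemma edge_diff_scale: "edge_diff (mscale c b) t = c * edge_diff b t"
  by (simp add: edge_diff_def case_prod_beta mscale_def algebra_simps)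

lemma energy_edges: "energy n b = (\<Sum>t\<in>edges n. (cmod (edge_diff b t))\<^sup>2)"
  unfolding energy_def tr_abs_sq edges_def edge_diff_def component_def Re_complex_of_real
  by (simp add: sum.cartesian_product case_prod_beta)

lemma sqrt_energy: "sqrt (energy n b) = L2_set (\<lambda>t. cmod (edge_diff b t)) (edges n)"
  by (simp add: energy_edges L2_set_def)

lemma sqrt_energy_add: "sqrt (energy n (a + b)) \<le> sqrt (energy n a) + sqrt (energy n b)"
proof -
  have "sqrt (energy n (a + b)) \<le> L2_set (\<lambda>t. cmod (edge_diff a t) + cmod (edge_diff b t)) (edges n)"
    unfolding sqrt_energy edge_diff_add by (intro L2_set_mono norm_triangle_ineq) auto
  also have "\<dots> \<le> sqrt (energy n a) + sqrt (energy n b)"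
    unfolding sqrt_energy by (rule L2_set_triangle_ineq)
  finally show ?thesis .
qed

lemma energy_scale: "energy n (mscale c b) = (cmod c)\<^sup>2 * energy n b"
  by (simp add: energy_edges edge_diff_scale norm_mult power_mult_distrib sum_distrib_left)

lemma sqrt_scaled_energy_add:
  "sqrt (scaled_energy (a + b) m) \<le> sqrt (scaled_energy a m) + sqrt (scaled_energy b m)"
  using mult_left_mono[OF sqrt_energy_add[of m "rho m a" "rho m b"], of "sqrt ((5 / 3) ^ m)"]
  by (simp add: scaled_energy_def rho_add real_sqrt_mult algebra_simps)

lemma scaled_energy_uscale: "scaled_energy (uscale c b) m = (cmod c)\<^sup>2 * scaled_energy b m"
  by (simp add: scaled_energy_def rho_uscale energy_scale)

text \<open>Stated for arbitrary elements because the symmetry axiom of \<open>Metric_space\<close>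
  ranges over the whole type.\<close>

lemma energy_inf_minus_commute: "energy_inf (a - b) = energy_inf (b - a)"
proof -
  have "scaled_energy (a - b) m = scaled_energy (b - a) m" for m
    using scaled_energy_uscale[of "- 1" "b - a" m] by simp
  then show ?thesis
    unfolding energy_inf_def scaled_energy_def[symmetric] by simp
qed

lemma subspace_A_fin: "mat.subspace (A_fin n)"
  unfolding A_fin_def by (rule mat.subspace_span)

lemma tendsto_uscale:
  assumes "X \<longlonglongrightarrow> b"
  shows "(\<lambda>n. uscale c (X n)) \<longlonglongrightarrow> uscale c b"
proof (rule LIM_zero_cancel, rule tendsto_norm_zero_cancel)
  have "(\<lambda>n. cmod c * norm (X n - b)) \<longlonglongrightarrow> cmod c * 0"
    using assms by (intro tendsto_mult_left tendsto_norm_zero LIM_zero)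
  then show "(\<lambda>n. norm (uscale c (X n) - uscale c b)) \<longlonglongrightarrow> 0"
    by (simp add: norm_uscale flip: uhf.scale_right_diff_distrib)
qed

lemma iota_zero: "iota n 0 = 0"
  using norm_iota[OF Mat_zero] opnorm_zero by (metis norm_eq_zero)

lemma subspace_A_inf: "uhf.subspace A_inf"
  unfolding uhf.subspace_def
proof (intro conjI ballI allI)
  show "0 \<in> A_inf"
    unfolding A_inf_def using mat.subspace_0[OF subspace_A_fin] iota_zero
    by (intro CollectI exI[of _ "\<lambda>n. 0"]) simp
next
  fix x y assume "x \<in> A_inf" "y \<in> A_inf"
  then obtain a b where a: "\<And>n. a n \<in> A_fin n" "(\<lambda>n. iota (n + 1) (a n)) \<longlonglongrightarrow> x"
    and b: "\<And>n. b n \<in> A_fin n" "(\<lambda>n. iota (n + 1) (b n)) \<longlonglongrightarrow> y"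
    by (auto simp: A_inf_def)
  have "(\<lambda>n. iota (n + 1) (a n + b n)) \<longlonglongrightarrow> x + y"
    using tendsto_add[OF a(2) b(2)] iota_add[OF Mat_A_fin Mat_A_fin] a(1) b(1) by simp
  then show "x + y \<in> A_inf"
    unfolding A_inf_def using a b mat.subspace_add[OF subspace_A_fin]
    by (auto intro!: exI[of _ "\<lambda>n. a n + b n"])
next
  fix c x assume "x \<in> A_inf"
  then obtain a where a: "\<And>n. a n \<in> A_fin n" "(\<lambda>n. iota (n + 1) (a n)) \<longlonglongrightarrow> x"
    by (auto simp: A_inf_def)
  have "(\<lambda>n. iota (n + 1) (mscale c (a n))) \<longlonglongrightarrow> uscale c x"
    using tendsto_uscale[OF a(2)] iota_scale[OF Mat_A_fin] a(1) by simp
  then show "uscale c x \<in> A_inf"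
    unfolding A_inf_def using a mat.subspace_scale[OF subspace_A_fin]
    by (auto intro!: exI[of _ "\<lambda>n. mscale c (a n)"])
qed

lemma sqrt_real_energy_tendsto:
  "b \<in> energy_dom \<Longrightarrow> (\<lambda>m. sqrt (scaled_energy b m)) \<longlonglongrightarrow> sqrt (real_energy b)"
  by (intro tendsto_real_sqrt real_energy_tendsto)

lemma subspace_energy_dom: "uhf.subspace energy_dom"
  unfolding uhf.subspace_def
proof (intro conjI ballI allI)
  have "scaled_energy 0 m \<le> 0" for m
    using scaled_energy_uscale[of 0 0 m] by simp
  then show "0 \<in> energy_dom"
    using energy_domI uhf.subspace_0[OF subspace_A_inf] by blast
next
  fix a b assume ab: "a \<in> energy_dom" "b \<in> energy_dom"
  have "sqrt (scaled_energy (a + b) m) \<le> sqrt (real_energy a) + sqrt (real_energy b)" for m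
    using sqrt_scaled_energy_add[of a b m] ab[THEN scaled_energy_le, of m, THEN real_sqrt_le_mono] by linarith
  then have "scaled_energy (a + b) m \<le> (sqrt (real_energy a) + sqrt (real_energy b))\<^sup>2" for m
    using sqrt_le_D by blast
  then show "a + b \<in> energy_dom"
    using energy_domI[OF uhf.subspace_add[OF subspace_A_inf ab[THEN energy_dom_A_inf]]] by blast
next
  fix c b assume b: "b \<in> energy_dom"
  have "scaled_energy (uscale c b) m \<le> (cmod c)\<^sup>2 * real_energy b" for m
    by (simp add: scaled_energy_uscale scaled_energy_le[OF b] mult_left_mono)
  then show "uscale c b \<in> energy_dom"
    by (rule energy_domI[OF uhf.subspace_scale[OF subspace_A_inf energy_dom_A_inf[OF b]]])
qed

lemma sqrt_real_energy_add:
  assumes "a \<in> energy_dom" "b \<in> energy_dom"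
  shows "sqrt (real_energy (a + b)) \<le> sqrt (real_energy a) + sqrt (real_energy b)"
  by (rule LIMSEQ_le[OF sqrt_real_energy_tendsto[OF uhf.subspace_add[OF subspace_energy_dom assms]]
        tendsto_add[OF assms[THEN sqrt_real_energy_tendsto]]])
     (simp add: sqrt_scaled_energy_add)

lemma real_energy_uscale:
  assumes "b \<in> energy_dom"
  shows "real_energy (uscale c b) = (cmod c)\<^sup>2 * real_energy b"
  using real_energy_tendsto[OF uhf.subspace_scale[OF subspace_energy_dom assms], of c]
    tendsto_mult_left[OF real_energy_tendsto[OF assms], of "(cmod c)\<^sup>2"]
  by (auto simp: scaled_energy_uscale[abs_def] intro: LIMSEQ_unique)

section \<open>The sesquilinear forms behind the energies\<close>

definition eform :: "nat \<Rightarrow> uhf \<Rightarrow> uhf \<Rightarrow> complex" where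
  "eform m a b = (5 / 3) ^ m * (\<Sum>t\<in>edges m. cnj (edge_diff (rho m a) t) * edge_diff (rho m b) t)"

definition limit_form :: "uhf \<Rightarrow> uhf \<Rightarrow> complex" where
  "limit_form a b = lim (\<lambda>m. eform m a b)"

lemma eform_add:
  "eform m a (b + b') = eform m a b + eform m a b'" "eform m (b + b') a = eform m b a + eform m b' a"
  by (simp_all add: eform_def rho_add edge_diff_add algebra_simps sum.distrib)

lemma eform_uscale:
  "eform m a (uscale c b) = c * eform m a b" "eform m (uscale c a) b = cnj c * eform m a b"
  by (simp_all add: eform_def rho_uscale edge_diff_scale sum_distrib_left mult_ac)

lemma eform_diag: "eform m b b = complex_of_real (scaled_energy b m)"
proof -
  have "complex_of_real (energy m (rho m b))
      = (\<Sum>t\<in>edges m. cnj (edge_diff (rho m b) t) * edge_diff (rho m b) t)"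
    unfolding energy_edges of_real_sum complex_norm_square by (simp add: mult.commute)
  then show ?thesis
    by (simp add: eform_def scaled_energy_def)
qed

text \<open>By conjugate linearity in the first argument, weighting the energy of
  \<open>b + uscale c a\<close> by \<open>c\<close> and summing over the fourth roots of unity
  \<open>c\<close> isolates \<open>eform m a b\<close>.\<close>

lemma eform_polarization:
  "4 * eform m a b = complex_of_real (scaled_energy (b + a) m) - complex_of_real (scaled_energy (b + uscale (- 1) a) m)
    + \<i> * (complex_of_real (scaled_energy (b + uscale \<i> a) m)
      - complex_of_real (scaled_energy (b + uscale (- \<i>) a) m))"
  unfolding eform_diag[symmetric] eform_add eform_uscale by (simp add: algebra_simps)

text \<open>Polarization expresses the form through four energies of elements of
  \<open>energy_dom\<close>, each of which converges.\<close>

lemma eform_tendsto: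
  assumes "a \<in> energy_dom" "b \<in> energy_dom"
  shows "(\<lambda>m. eform m a b) \<longlonglongrightarrow> limit_form a b"
proof -
  have S: "(\<lambda>m. complex_of_real (scaled_energy (b + uscale c a) m))
      \<longlonglongrightarrow> complex_of_real (real_energy (b + uscale c a))" for c
    by (intro tendsto_of_real real_energy_tendsto uhf.subspace_add[OF subspace_energy_dom]
        uhf.subspace_scale[OF subspace_energy_dom] assms)
  have eq: "eform m a b = (complex_of_real (scaled_energy (b + uscale 1 a) m)
      - complex_of_real (scaled_energy (b + uscale (- 1) a) m)
    + \<i> * (complex_of_real (scaled_energy (b + uscale \<i> a) m)
      - complex_of_real (scaled_energy (b + uscale (- \<i>) a) m))) / 4" for m
    using eform_polarization[of m a b] by (simp add: eq_divide_eq mult.commute)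
  have "convergent (\<lambda>m. eform m a b)"
    unfolding eq
    by (rule convergentI[OF tendsto_divide[OF tendsto_add[OF tendsto_diff[OF S[of 1] S[of "- 1"]]
      tendsto_mult[OF tendsto_const[of \<i>] tendsto_diff[OF S[of \<i>] S[of "- \<i>"]]]] tendsto_const[of 4]]]) simp
  then show ?thesis
    by (simp add: limit_form_def convergent_LIMSEQ_iff)
qed

lemma limit_form_diag: "b \<in> energy_dom \<Longrightarrow> limit_form b b = complex_of_real (real_energy b)"
  unfolding limit_form_def eform_diag by (intro limI tendsto_of_real real_energy_tendsto)

lemma sesquilinear_limit_form: "sesquilinear_on energy_dom limit_form"
  unfolding sesquilinear_on_def
proof (intro conjI ballI allI)
  note dom = uhf.subspace_add[OF subspace_energy_dom] uhf.subspace_scale[OF subspace_energy_dom]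
  fix a b assume a: "a \<in> energy_dom" and b: "b \<in> energy_dom"
  show "limit_form a (b + b') = limit_form a b + limit_form a b'"
    "limit_form (b + b') a = limit_form b a + limit_form b' a" if b': "b' \<in> energy_dom" for b'
    using eform_tendsto[OF a dom(1)[OF b b']] eform_tendsto[OF dom(1)[OF b b'] a]
      tendsto_add[OF eform_tendsto[OF a b] eform_tendsto[OF a b']]
      tendsto_add[OF eform_tendsto[OF b a] eform_tendsto[OF b' a]]
    unfolding eform_add by (auto intro: LIMSEQ_unique)
  fix c
  show "limit_form a (uscale c b) = c * limit_form a b"
    "limit_form (uscale c a) b = cnj c * limit_form a b"
    using eform_tendsto[OF a dom(2)[OF b]] eform_tendsto[OF dom(2)[OF a] b]
      tendsto_mult_left[OF eform_tendsto[OF a b]]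
    unfolding eform_uscale by (blast intro: LIMSEQ_unique)+
qed

lemma quadratic_form_energy_inf: "quadratic_form_on A_inf energy_inf"
  unfolding quadratic_form_on_def energy_dom_def[symmetric]
proof (intro conjI exI[of _ limit_form])
  show "\<forall>b\<in>A_inf. energy_inf b < \<infinity> \<longrightarrow> limit_form b b = complex_of_real (enn2real (energy_inf b))"
    by (auto simp: limit_form_diag energy_dom_def simp flip: real_energy_def)
qed (rule subspace_A_inf subspace_energy_dom sesquilinear_limit_form)+

section \<open>Completeness of the form domain\<close>

text \<open>Replaces the approximating sequence by an epsilon condition at each large level, which
  is easier to verify for limits.\<close>

lemma A_inf_iff:
  "b \<in> A_inf \<longleftrightarrow> (\<forall>e>0. \<exists>N. \<forall>n\<ge>N. \<exists>a\<in>A_fin n. norm (iota (n + 1) a - b) < e)"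
proof
  assume "b \<in> A_inf"
  then show "\<forall>e>0. \<exists>N. \<forall>n\<ge>N. \<exists>a\<in>A_fin n. norm (iota (n + 1) a - b) < e"
    unfolding A_inf_def LIMSEQ_iff by blast
next
  assume approx: "\<forall>e>0. \<exists>N. \<forall>n\<ge>N. \<exists>a\<in>A_fin n. norm (iota (n + 1) a - b) < e"
  \<comment> \<open>A sequence is obtained by choosing at each level a nearly best approximation;
    the slack \<open>1 / Suc n\<close> avoids having to attain the infimum.\<close>
  have "\<exists>a\<in>A_fin n. \<forall>y\<in>A_fin n. norm (iota (n + 1) a - b) < norm (iota (n + 1) y - b) + 1 / Suc n" for n
  proof -
    let ?S = "(\<lambda>y. norm (iota (n + 1) y - b)) ` A_fin n"
    have ne: "?S \<noteq> {}"
      using mat.subspace_0[OF subspace_A_fin] by blast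
    have bd: "bdd_below ?S"
      by (auto intro: bdd_belowI[of _ 0])
    have "Inf ?S < Inf ?S + 1 / Suc n" by simp
    from cInf_lessD[OF ne this] obtain a
      where a: "a \<in> A_fin n" "norm (iota (n + 1) a - b) < Inf ?S + 1 / Suc n" by blast
    have "norm (iota (n + 1) a - b) < norm (iota (n + 1) y - b) + 1 / Suc n" if "y \<in> A_fin n" for y
      using a(2) cInf_lower[OF imageI[OF that] bd] by linarith
    then show ?thesis using a(1) by blast
  qed
  then obtain a where a: "\<And>n. a n \<in> A_fin n"
    and amin: "\<And>n y. y \<in> A_fin n \<Longrightarrow> norm (iota (n + 1) (a n) - b) < norm (iota (n + 1) y - b) + 1 / Suc n"
    by metis
  have "(\<lambda>n. iota (n + 1) (a n)) \<longlonglongrightarrow> b"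
  proof (rule LIMSEQ_I)
    fix e :: real assume "0 < e"
    then have e: "0 < e / 2" by simp
    with approx obtain N where N: "\<And>n. N \<le> n \<Longrightarrow> \<exists>y\<in>A_fin n. norm (iota (n + 1) y - b) < e / 2"
      by blast
    obtain L where L: "1 / real (Suc L) < e / 2"
      using nat_approx_posE[OF e] by blast
    have "norm (iota (n + 1) (a n) - b) < e" if n: "max N L \<le> n" for n
    proof -
      obtain y where "y \<in> A_fin n" "norm (iota (n + 1) y - b) < e / 2"
        using N[of n] n by auto
      moreover have "1 / real (Suc n) \<le> 1 / real (Suc L)"
        using n by (simp add: frac_le)
      ultimately show ?thesis
        using amin[of y n] L by linarith
    qed
    then show "\<exists>N. \<forall>n\<ge>N. norm (iota (n + 1) (a n) - b) < e" by blast
  qed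
  with a show "b \<in> A_inf"
    by (auto simp: A_inf_def)
qed

lemma A_inf_closed:
  assumes "\<And>k. X k \<in> A_inf" "X \<longlonglongrightarrow> b"
  shows "b \<in> A_inf"
  unfolding A_inf_iff
proof (intro allI impI)
  fix e :: real assume "0 < e"
  then have e: "0 < e / 2" by simp
  from LIMSEQ_D[OF assms(2) e] obtain k where k: "norm (X k - b) < e / 2"
    by blast
  from assms(1)[of k, unfolded A_inf_iff] e obtain N
    where N: "\<And>n. N \<le> n \<Longrightarrow> \<exists>a\<in>A_fin n. norm (iota (n + 1) a - X k) < e / 2" by blast
  have "\<exists>a\<in>A_fin n. norm (iota (n + 1) a - b) < e" if n: "N \<le> n" for n
  proof -
    obtain a where a: "a \<in> A_fin n" "norm (iota (n + 1) a - X k) < e / 2"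
      using N[OF n] by blast
    have "norm (iota (n + 1) a - b) \<le> norm (iota (n + 1) a - X k) + norm (X k - b)"
      using norm_triangle_ineq[of "iota (n + 1) a - X k" "X k - b"] by simp
    then show ?thesis
      using a k by (intro bexI[of _ a]) auto
  qed
  then show "\<exists>N. \<forall>n\<ge>N. \<exists>a\<in>A_fin n. norm (iota (n + 1) a - b) < e" by blast
qed

text \<open>At a fixed level the energy is a polynomial expression in the real and imaginary parts
  of finitely many entries of \<open>rho m\<close>, each continuous in the uniform norm.\<close>

lemma scaled_energy_tendsto:
  assumes "X \<longlonglongrightarrow> b"
  shows "(\<lambda>n. scaled_energy (X n) m) \<longlonglongrightarrow> scaled_energy b m"
  unfolding scaled_energy_def energy_edges edge_diff_def case_prod_beta
  by (intro tendsto_intros rho_tendsto assms)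

lemma form_norm_real_energy: "form_norm b = sqrt ((norm b)\<^sup>2 + real_energy b)"
  by (simp add: form_norm_def real_energy_def)

lemma real_energy_nonneg [simp]: "0 \<le> real_energy b"
  by (simp add: real_energy_def)

lemma norm_le_form_norm: "norm b \<le> form_norm b"
  unfolding form_norm_real_energy by (rule real_le_rsqrt) simp

lemma norm_on_form_norm: "norm_on energy_dom form_norm"
  unfolding norm_on_def
proof (intro conjI ballI allI)
  show "uhf.subspace energy_dom"
    by (rule subspace_energy_dom)
next
  fix a assume a: "a \<in> energy_dom"
  show "0 \<le> form_norm a"
    using norm_le_form_norm[of a] norm_ge_zero order_trans by blast
  show "form_norm a = 0 \<longleftrightarrow> a = 0"
  proof
    assume "form_norm a = 0"
    then show "a = 0" using norm_le_form_norm[of a] by simp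
  next
    assume "a = 0"
    moreover have "real_energy 0 = 0"
      using real_energy_uscale[of 0 0] uhf.subspace_0[OF subspace_energy_dom] by simp
    ultimately show "form_norm a = 0"
      by (simp add: form_norm_real_energy)
  qed
  show "form_norm (uscale c a) = cmod c * form_norm a" for c
    unfolding form_norm_real_energy norm_uscale real_energy_uscale[OF a] power_mult_distrib
    by (simp add: real_sqrt_mult flip: distrib_left)
  fix b assume b: "b \<in> energy_dom"
  have "form_norm (a + b) = sqrt ((norm (a + b))\<^sup>2 + (sqrt (real_energy (a + b)))\<^sup>2)"
    by (simp add: form_norm_real_energy)
  \<comment> \<open>The form norm is the Euclidean length of the pair of \<open>norm\<close> and
    \<open>sqrt\<close> of the energy, so the triangle inequalities of both components combine in
    the plane.\<close>
  also have "\<dots> \<le> sqrt ((norm a + norm b)\<^sup>2 + (sqrt (real_energy a) + sqrt (real_energy b))\<^sup>2)"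
    by (intro real_sqrt_le_mono add_mono power_mono norm_triangle_ineq sqrt_real_energy_add a b) auto
  also have "\<dots> \<le> sqrt ((norm a)\<^sup>2 + (sqrt (real_energy a))\<^sup>2) + sqrt ((norm b)\<^sup>2 + (sqrt (real_energy b))\<^sup>2)"
    by (rule real_sqrt_sum_squares_triangle_ineq)
  also have "\<dots> = form_norm a + form_norm b"
    by (simp add: form_norm_real_energy)
  finally show "form_norm (a + b) \<le> form_norm a + form_norm b" .
qed

text \<open>Completeness rests on lower semicontinuity: each renormalized energy is continuous for the
  uniform norm, so a bound on the energies of \<open>X n - X k\<close> passes to the limit in \<open>k\<close>.\<close>

lemma form_norm_limit_le:
  assumes dom: "\<And>k. X k \<in> energy_dom" and lim: "X \<longlonglongrightarrow> b"
    and le: "\<And>k. N \<le> k \<Longrightarrow> form_norm (X n - X k) \<le> e"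
  shows "X n - b \<in> energy_dom" "form_norm (X n - b) \<le> e"
proof -
  have "0 \<le> form_norm (X n - X N)"
    using norm_le_form_norm norm_ge_zero order_trans by blast
  then have e: "0 \<le> e"
    using le[of N] by simp
  have "(norm (X n - b))\<^sup>2 + scaled_energy (X n - b) m \<le> e\<^sup>2" for m
  proof (rule LIMSEQ_le_const2)
    show "(\<lambda>k. (norm (X n - X k))\<^sup>2 + scaled_energy (X n - X k) m)
        \<longlonglongrightarrow> (norm (X n - b))\<^sup>2 + scaled_energy (X n - b) m"
      by (intro tendsto_intros scaled_energy_tendsto lim)
    have "(norm (X n - X k))\<^sup>2 + scaled_energy (X n - X k) m \<le> e\<^sup>2" if "N \<le> k" for k
    proof -
      have "X n - X k \<in> energy_dom"
        by (intro uhf.subspace_diff[OF subspace_energy_dom] dom)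
      then show ?thesis
        using sqrt_le_D[OF le[OF that, unfolded form_norm_real_energy]]
          scaled_energy_le[of "X n - X k" m] by linarith
    qed
    then show "\<exists>K. \<forall>k\<ge>K. (norm (X n - X k))\<^sup>2 + scaled_energy (X n - X k) m \<le> e\<^sup>2" by blast
  qed
  \<comment> \<open>The right-hand side is independent of \<open>m\<close>, so the bound extends to
    the limit energy.\<close>
  then have bound: "scaled_energy (X n - b) m \<le> e\<^sup>2 - (norm (X n - b))\<^sup>2" for m
    by (simp add: algebra_simps)
  have "b \<in> A_inf"
    using A_inf_closed[OF energy_dom_A_inf[OF dom] lim] .
  then show "X n - b \<in> energy_dom"
    using energy_domI[OF uhf.subspace_diff[OF subspace_A_inf energy_dom_A_inf[OF dom]] bound] by blast
  from real_energy_leI[OF this bound] show "form_norm (X n - b) \<le> e"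
    unfolding form_norm_real_energy by (intro real_le_lsqrt) (auto simp: e algebra_simps)
qed

text \<open>The form norm dominates the uniform norm, so a Cauchy sequence has a uniform limit;
  \<open>form_norm_limit_le\<close> upgrades the convergence to the form norm.\<close>

lemma complete_energy_dom: "complete_for_norm energy_dom form_norm"
  unfolding complete_for_norm_def
proof (rule conjI[OF norm_on_form_norm])
  have sub: "a - b \<in> energy_dom" if "a \<in> energy_dom" "b \<in> energy_dom" for a b
    using that by (rule uhf.subspace_diff[OF subspace_energy_dom])
  interpret D: Metric_space energy_dom "\<lambda>a b. form_norm (a - b)"
  proof
    fix a b c :: uhf
    show "0 \<le> form_norm (a - b)"
      using norm_le_form_norm norm_ge_zero order_trans by blast
    show "form_norm (a - b) = form_norm (b - a)"
      by (simp add: form_norm_def norm_minus_commute energy_inf_minus_commute[of a b])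
    assume a: "a \<in> energy_dom" and b: "b \<in> energy_dom"
    show "form_norm (a - b) = 0 \<longleftrightarrow> a = b"
      using norm_on_form_norm sub[OF a b] by (simp add: norm_on_def)
    assume c: "c \<in> energy_dom"
    show "form_norm (a - c) \<le> form_norm (a - b) + form_norm (b - c)"
      using norm_on_form_norm sub[OF a b] sub[OF b c] unfolding norm_on_def
      by (metis diff_add_cancel add_diff_eq)
  qed
  show "D.mcomplete"
    unfolding D.mcomplete_def
  proof (intro allI impI)
    fix X assume X: "D.MCauchy X"
    then have dom: "X k \<in> energy_dom" for k
      by (auto simp: D.MCauchy_def)
    have cauchy: "\<exists>N. \<forall>n k. N \<le> n \<longrightarrow> N \<le> k \<longrightarrow> form_norm (X n - X k) < e" if "0 < e" for e
      using X that by (auto simp: D.MCauchy_def)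
    have "Cauchy X"
    proof (rule CauchyI)
      fix e :: real assume "0 < e"
      from cauchy[OF this] show "\<exists>N. \<forall>n\<ge>N. \<forall>k\<ge>N. norm (X n - X k) < e"
        using norm_le_form_norm le_less_trans by blast
    qed
    then obtain b where b: "X \<longlonglongrightarrow> b"
      using convergent_eq_Cauchy by blast
    have lim: "\<exists>N. \<forall>n\<ge>N. X n - b \<in> energy_dom \<and> form_norm (X n - b) < e" if "0 < e" for e
    proof -
      have "0 < e / 2" using that by simp
      from cauchy[OF this] obtain N
        where N: "\<And>n k. N \<le> n \<Longrightarrow> N \<le> k \<Longrightarrow> form_norm (X n - X k) < e / 2" by blast
      have "X n - b \<in> energy_dom \<and> form_norm (X n - b) < e" if "N \<le> n" for n
        using form_norm_limit_le[where N = N, OF dom b less_imp_le[OF N[OF that]]] \<open>0 < e\<close> by auto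
      then show ?thesis by blast
    qed
    \<comment> \<open>So far only differences lie in the domain; \<open>b\<close> follows from
      \<open>b = X n - (X n - b)\<close>.\<close>
    obtain n where "X n - b \<in> energy_dom"
      using lim[of 1] by auto
    from sub[OF dom[of n] this] have "b \<in> energy_dom"
      by simp
    moreover have "\<exists>N. \<forall>n\<ge>N. X n \<in> energy_dom \<and> form_norm (X n - b) < e" if "0 < e" for e
      using lim[OF that] dom by (elim exE, intro exI) blast
    ultimately have "limitin D.mtopology X b sequentially"
      by (simp add: D.limit_metric_sequentially)
    then show "\<exists>b. limitin D.mtopology X b sequentially" ..
  qed
qed

section \<open>Harmonic extension\<close>

lemma tensor_assoc: "tensor (m + k) (tensor m x y) z = tensor m x (tensor k y z)"
proof (intro ext)
  fix u v :: word3
  have "take m (take (m + k) w) = take m w" "drop m (take (m + k) w) = take k (drop m w)"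
    "drop (m + k) w = drop k (drop m w)" for w :: word3
    by (simp_all add: min_absorb1 drop_take add.commute)
  then show "tensor (m + k) (tensor m x y) z u v = tensor m x (tensor k y z) u v"
    by (simp only: tensor_def mult.assoc)
qed

text \<open>Here \<open>y\<close> is the diagonal projection onto the words in \<open>S\<close>;
  tensoring with the unit \<open>munit 2 2\<close> appends the letter 2 to each of them.\<close>

lemma tensor_rank_one:
  assumes "\<And>u v. y u v = of_bool (u = v \<and> u \<in> S)" "\<And>x. x \<in> S \<Longrightarrow> length x = k"
  shows "tensor k y (munit 2 2) u v = of_bool (u = v \<and> u \<in> (\<lambda>x. x @ [2]) ` S)"
proof -
  have *: "take k w \<in> S \<and> drop k w = [2] \<longleftrightarrow> w \<in> (\<lambda>x. x @ [2]) ` S" for w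
  proof
    assume "take k w \<in> S \<and> drop k w = [2]"
    then show "w \<in> (\<lambda>x. x @ [2]) ` S"
      using append_take_drop_id[of k w] by (intro image_eqI[of _ _ "take k w"]) auto
  next
    assume "w \<in> (\<lambda>x. x @ [2]) ` S"
    then show "take k w \<in> S \<and> drop k w = [2]"
      using assms(2) by auto
  qed
  have "u = v \<longleftrightarrow> take k u = take k v \<and> drop k u = drop k v"
    by (metis append_take_drop_id)
  then have eq: "u = v \<and> u \<in> (\<lambda>x. x @ [2]) ` S
      \<longleftrightarrow> take k u = take k v \<and> take k u \<in> S \<and> drop k u = [2] \<and> drop k v = [2]"
    using *[of u] by argo
  show ?thesis
    unfolding eq tensor_def assms(1) munit_entry of_bool_conj mult.assoc by (rule refl)
qed

lemma alpha_Suc: "tensor (n + 1) (alpha n j) (munit 2 2) = alpha (Suc n) j"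
proof (intro ext)
  fix u v
  show "tensor (n + 1) (alpha n j) (munit 2 2) u v = alpha (Suc n) j u v"
    by (subst tensor_rank_one[where S = "{j # replicate n 2}"])
       (auto simp: alpha_entry replicate_append_same)
qed

lemma beta_Suc:
  assumes "1 \<le> k"
  shows "tensor (k + 1) (beta k j) (munit 2 2) = beta (Suc k) j"
proof (intro ext)
  fix u v
  have "replicate (k - 1) (2::3) @ [2] = replicate (Suc k - 1) 2"
    using assms by (simp add: replicate_append_same flip: replicate_Suc)
  then show "tensor (k + 1) (beta k j) (munit 2 2) u v = beta (Suc k) j u v"
    using assms
    by (subst tensor_rank_one[where S = "{j # 1 # replicate (k - 1) 2, (j + 2) # 3 # replicate (k - 1) 2}"])
       (auto simp: beta_entry)
qed

lemma A_fin_alpha: "alpha n j \<in> A_fin n"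
  unfolding A_fin_def by (rule mat.span_base) blast

lemma A_fin_beta: "1 \<le> k \<Longrightarrow> k \<le> n \<Longrightarrow> x \<in> Mat (n - k) \<Longrightarrow> tensor (n - k) x (beta k j) \<in> A_fin n"
  unfolding A_fin_def by (rule mat.span_base) blast

lemma tensor_add_left: "tensor n (x + y) z = tensor n x z + tensor n y z"
  by (simp add: tensor_def fun_eq_iff algebra_simps)

lemma tensor_scale_left: "tensor n (mscale c x) z = mscale c (tensor n x z)"
  by (simp add: tensor_def mscale_def fun_eq_iff)

lemma tensor_zero_left: "tensor n 0 z = 0"
  by (simp add: tensor_def fun_eq_iff)

text \<open>Appending the factor \<open>munit 2 2\<close> maps generators to generators:
  \<open>alpha n\<close> to \<open>alpha (Suc n)\<close>, and \<open>beta k\<close> to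
  \<open>beta (Suc k)\<close> with the same coefficient.\<close>

lemma A_fin_tensor_munit: "a \<in> A_fin n \<Longrightarrow> tensor (n + 1) a (munit 2 2) \<in> A_fin (Suc n)"
proof (induction rule: A_fin_induct)
  case (alpha j)
  show ?case unfolding alpha_Suc by (rule A_fin_alpha)
next
  case (beta k j x)
  have "tensor (n + 1) (tensor (n - k) x (Defs.beta k j)) (munit 2 2)
      = tensor (Suc n - Suc k) x (Defs.beta (Suc k) j)"
    using tensor_assoc[of "n - k" "k + 1" x "Defs.beta k j" "munit 2 2"] beta(1,2) by (simp add: beta_Suc[simplified])
  then show ?case
    using A_fin_beta[of "Suc k" "Suc n" x j] beta by simp
next
  case zero
  show ?case unfolding tensor_zero_left by (rule mat.subspace_0[OF subspace_A_fin])
next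
  case (add x y)
  then show ?case unfolding tensor_add_left by (rule mat.subspace_add[OF subspace_A_fin])
next
  case (scale c x)
  then show ?case unfolding tensor_scale_left by (rule mat.subspace_scale[OF subspace_A_fin])
qed

definition junction :: "mat \<Rightarrow> 3 \<Rightarrow> mat" where
  "junction a j = (\<lambda>u v. harm (\<lambda>i. component a i u v) j)"

text \<open>The first term puts the old corner values at the last letter 2; the terms with
  \<open>beta 1 j\<close> place the junction values at the last letters 1 and 3, once for each of
  the two cells sharing them.\<close>

definition harm_ext :: "nat \<Rightarrow> mat \<Rightarrow> mat" where
  "harm_ext n a = tensor (n + 1) a (munit 2 2) + (\<Sum>j\<in>UNIV. tensor n (junction a j) (beta 1 j))"

lemma A_fin_harm_ext:
  assumes "a \<in> A_fin n"
  shows "harm_ext n a \<in> A_fin (Suc n)"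
proof -
  have "a (u @ [i]) (v @ [i]) = 0" if "u \<notin> words n \<or> v \<notin> words n" for u v i
    by (rule Mat_D[OF Mat_A_fin[OF assms]]) (use that in \<open>auto simp: words_def\<close>)
  then have "junction a j \<in> Mat n" for j
    by (simp add: Mat_iff junction_def component_def harm_def)
  then have "tensor n (junction a j) (beta 1 j) \<in> A_fin (Suc n)" for j
    using A_fin_beta[of 1 "Suc n" "junction a j" j] by simp
  then show ?thesis
    unfolding harm_ext_def
    by (intro mat.subspace_add[OF subspace_A_fin] mat.subspace_sum[OF subspace_A_fin]
        A_fin_tensor_munit assms)
qed

lemma sum_fun_apply: "(\<Sum>j\<in>S. f j) u v = (\<Sum>j\<in>S. f j u v)" for f :: "'a \<Rightarrow> mat"
  by (induction S rule: infinite_finite_induct) auto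

lemma three_shift: "p + 1 + 2 = p" "p + 2 + 1 = p" "p + 1 + 1 = p + 2" for p :: 3
  using exhaust_3[of p] by auto

lemma harm_ext_entry:
  assumes a: "a \<in> A_fin n" and uv: "u \<in> words n" "v \<in> words n"
  shows "harm_ext n a (u @ [p, q]) (v @ [p', q']) =
    (if p = p' \<and> q = q' then cell (\<lambda>i. component a i u v) (\<lambda>j. junction a j u v) p q else 0)"
proof -
  have diag: "a (u @ [p]) (v @ [p']) = (if p = p' then component a p u v else 0)"
    using A_fin_diag[OF a, of "u @ [p]" "v @ [p']"] uv by (auto simp: component_def words_def)
  have one: "tensor (n + 1) a (munit 2 2) (u @ [p, q]) (v @ [p', q'])
      = (if p = p' \<and> q = 2 \<and> q' = 2 then component a p u v else 0)"
    using uv diag by (auto simp: tensor_def words_def munit_entry)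
  \<comment> \<open>In cell \<open>p\<close>, vertex 3 receives a contribution from
    \<open>beta 1 j\<close> for \<open>j = p + 1\<close> alone.\<close>
  have shift: "p = j + 2 \<longleftrightarrow> j = p + 1" for j
    using three_shift(1)[of p] three_shift(2)[of j] by auto
  have "(\<Sum>j\<in>UNIV. tensor n (junction a j) (beta 1 j)) (u @ [p, q]) (v @ [p', q'])
      = (\<Sum>j\<in>UNIV. if p = p' \<and> q = q' \<and> (j = p \<and> q = 1 \<or> j = p + 1 \<and> q = 3) then junction a j u v else 0)"
    unfolding sum_fun_apply
    using uv by (intro sum.cong) (auto simp: tensor_def words_def beta_entry shift)
  also have "\<dots> = (if p = p' \<and> q = q' then if q = 1 then junction a p u v else
      if q = 3 then junction a (p + 1) u v else 0 else 0)"
  proof (cases "p = p' \<and> q = q'")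
    case True
    then show ?thesis
      using exhaust_3[of q] by (elim disjE) simp_all
  next
    case False
    then show ?thesis
      by (simp only: if_False) (intro sum.neutral, auto)
  qed
  finally show ?thesis
    using exhaust_3[of q] unfolding harm_ext_def plus_fun_apply one cell_def by auto
qed

lemma cell_apply: "cell A X p q u v = cell (\<lambda>i. A i u v) (\<lambda>j. X j u v) p q"
  by (simp add: cell_def)

text \<open>The blocks off the diagonal are zero, and on the diagonal both error terms of
  \<open>gasket_identity\<close> vanish, the junctions being harmonic.\<close>

lemma energy_harm_ext:
  assumes "a \<in> A_fin n"
  shows "energy (Suc n) (harm_ext n a) = 3 / 5 * energy n a"
proof -
  have "(\<Sum>p\<in>UNIV. \<Sum>p'\<in>UNIV. tri (\<lambda>i. harm_ext n a (w @ [p', i]) (u @ [p, i])))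
      = 3 / 5 * tri (\<lambda>i. a (w @ [i]) (u @ [i]))" if uw: "u \<in> words n" "w \<in> words n" for u w
  proof -
    let ?a = "\<lambda>i. component a i w u"
    have "tri (\<lambda>i. harm_ext n a (w @ [p', i]) (u @ [p, i])) = (if p' = p then tri (cell ?a (harm ?a) p) else 0)"
      for p p'
      by (simp add: harm_ext_entry[OF assms uw(2,1)] junction_def tri_expand)
    then have "(\<Sum>p\<in>UNIV. \<Sum>p'\<in>UNIV. tri (\<lambda>i. harm_ext n a (w @ [p', i]) (u @ [p, i])))
        = (\<Sum>p\<in>UNIV. tri (cell ?a (harm ?a) p))"
      by simp
    also have "\<dots> = 3 / 5 * tri ?a"
      unfolding gasket_identity by (simp add: tri_expand)
    finally show ?thesis
      by (simp add: component_def)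
  qed
  then show ?thesis
    unfolding energy_Suc energy_tri[of n] sum_distrib_left by (intro sum.cong refl)
qed

text \<open>The state reads off the vertex 2 of each cell, which is where the original corner value
  is kept.\<close>

lemma slice_harm_ext:
  assumes "a \<in> A_fin n"
  shows "slice (n + 1) (n + 2) (harm_ext n a) = a"
proof (intro ext)
  fix u v
  show "slice (n + 1) (n + 2) (harm_ext n a) u v = a u v"
  proof (cases "u \<in> words (n + 1) \<and> v \<in> words (n + 1)")
    case True
    obtain u' p where u: "u = u' @ [p]" "u' \<in> words n"
      using True by (cases u rule: rev_cases) (auto simp: words_def)
    obtain v' p' where v: "v = v' @ [p']" "v' \<in> words n"
      using True by (cases v rule: rev_cases) (auto simp: words_def)
    show ?thesis
      using harm_ext_entry[OF assms u(2) v(2), of p 2 p' 2] A_fin_diag[OF assms, of u v] True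
      by (auto simp: slice_def u(1) v(1) cell_def component_def)
  next
    case False
    have "harm_ext n a \<in> Mat (n + 2)"
      using Mat_A_fin[OF A_fin_harm_ext[OF assms]] by simp
    then show ?thesis
      using False Mat_D[OF Mat_slice[of "harm_ext n a" "n + 2" "n + 1"], of u v]
        Mat_D[OF Mat_A_fin[OF assms], of u v] by auto
  qed
qed

section \<open>Operator norms of block diagonal matrices\<close>

lemma opnorm_cong:
  assumes "\<And>u v. u \<in> words n \<Longrightarrow> v \<in> words n \<Longrightarrow> x u v = y u v"
  shows "opnorm n x = opnorm n y"
proof -
  have "l2 n (mapply n x \<xi>) = l2 n (mapply n y \<xi>)" for \<xi>
    unfolding l2_def by (rule L2_set_cong) (auto simp: mapply_def assms)
  then show ?thesis
    by (simp add: opnorm_def)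
qed

lemma l2_Suc: "(l2 (Suc n) \<xi>)\<^sup>2 = (\<Sum>p\<in>UNIV. (l2 n (\<lambda>u. \<xi> (u @ [p])))\<^sup>2)"
  unfolding l2_sq sum_words_Suc by (rule sum.swap)

text \<open>Splitting vectors by their last letter decomposes the Hilbert space orthogonally into
  subspaces on which the blocks act separately.\<close>

lemma opnorm_block_diagonal_le:
  assumes "0 \<le> c" "\<And>p. opnorm n (component y p) \<le> c"
    and off: "\<And>u v p q. u \<in> words n \<Longrightarrow> v \<in> words n \<Longrightarrow> p \<noteq> q \<Longrightarrow> y (u @ [p]) (v @ [q]) = 0"
  shows "opnorm (Suc n) y \<le> c"
proof (rule opnorm_leI)
  fix \<xi> :: "word3 \<Rightarrow> complex"
  have "mapply (Suc n) y \<xi> (u @ [p]) = mapply n (component y p) (\<lambda>v. \<xi> (v @ [p])) u"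
    if "u \<in> words n" for u p
  proof -
    have "mapply (Suc n) y \<xi> (u @ [p])
        = (\<Sum>v\<in>words n. \<Sum>q\<in>UNIV. if q = p then y (u @ [p]) (v @ [p]) * \<xi> (v @ [p]) else 0)"
      unfolding mapply_def sum_words_Suc using off[OF that] by (intro sum.cong refl) auto
    then show ?thesis
      by (simp add: mapply_def component_def)
  qed
  then have "(l2 (Suc n) (mapply (Suc n) y \<xi>))\<^sup>2
      = (\<Sum>p\<in>UNIV. (l2 n (mapply n (component y p) (\<lambda>v. \<xi> (v @ [p]))))\<^sup>2)"
    unfolding l2_Suc by (simp add: l2_def cong: L2_set_cong_simp)
  also have "\<dots> \<le> (\<Sum>p\<in>UNIV. (c * l2 n (\<lambda>v. \<xi> (v @ [p])))\<^sup>2)"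
    by (intro sum_mono power_mono order_trans[OF opnorm_bound] mult_right_mono assms) auto
  also have "\<dots> = (c * l2 (Suc n) \<xi>)\<^sup>2"
    by (simp add: power_mult_distrib l2_Suc sum_distrib_left)
  finally show "l2 (Suc n) (mapply (Suc n) y \<xi>) \<le> c * l2 (Suc n) \<xi>"
    by (rule power2_le_imp_le) (simp add: assms)
qed (rule assms)

lemma opnorm_component: "opnorm n (component y p) \<le> opnorm (Suc n) y"
proof (rule opnorm_leI)
  fix \<xi> :: "word3 \<Rightarrow> complex"
  \<comment> \<open>The vector \<xi> is placed on the words ending in \<open>p\<close> and extended
    by zero, which preserves its norm.\<close>
  define \<eta> where "\<eta> = (\<lambda>v. if last v = p then \<xi> (butlast v) else 0)"
  have "(l2 (Suc n) \<eta>)\<^sup>2 = (\<Sum>q\<in>UNIV. if q = p then (l2 n \<xi>)\<^sup>2 else 0)"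
    unfolding l2_Suc by (intro sum.cong refl) (simp add: \<eta>_def)
  then have \<eta>: "l2 (Suc n) \<eta> = l2 n \<xi>"
    by (simp add: power2_eq_iff_nonneg)
  have "mapply (Suc n) y \<eta> (u @ [p]) = mapply n (component y p) \<xi> u" for u
  proof -
    have "mapply (Suc n) y \<eta> (u @ [p])
        = (\<Sum>v\<in>words n. \<Sum>q\<in>UNIV. if q = p then y (u @ [p]) (v @ [p]) * \<xi> v else 0)"
      unfolding mapply_def sum_words_Suc by (intro sum.cong refl) (simp add: \<eta>_def)
    then show ?thesis
      by (simp add: mapply_def component_def)
  qed
  then have "(l2 n (mapply n (component y p) \<xi>))\<^sup>2 = (l2 n (\<lambda>u. mapply (Suc n) y \<eta> (u @ [p])))\<^sup>2"
    by simp
  also have "\<dots> \<le> (l2 (Suc n) (mapply (Suc n) y \<eta>))\<^sup>2"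
    unfolding l2_Suc by (rule member_le_sum) auto
  finally have "l2 n (mapply n (component y p) \<xi>) \<le> l2 (Suc n) (mapply (Suc n) y \<eta>)"
    by (rule power2_le_imp_le) simp
  then show "l2 n (mapply n (component y p) \<xi>) \<le> opnorm (Suc n) y * l2 n \<xi>"
    using opnorm_bound[of "Suc n" y \<eta>] \<eta> by simp
qed simp

section \<open>Density of the form domain\<close>

definition osc_le :: "nat \<Rightarrow> mat \<Rightarrow> real \<Rightarrow> bool" where
  "osc_le n a c \<longleftrightarrow> (\<forall>i j. opnorm n (component a i - component a j) \<le> c)"

lemma osc_le_nonneg: "osc_le n a c \<Longrightarrow> 0 \<le> c"
  unfolding osc_le_def using opnorm_nonneg order_trans by blast

lemma opnorm_combination:
  assumes "opnorm n x \<le> c" "opnorm n y \<le> c"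
  shows "opnorm n (mscale (2 / 5) x + mscale (1 / 5) y) \<le> 3 / 5 * c"
proof -
  have "opnorm n (mscale (2 / 5) x + mscale (1 / 5) y) \<le> 2 / 5 * opnorm n x + 1 / 5 * opnorm n y"
    using opnorm_triangle[of n "mscale (2 / 5) x" "mscale (1 / 5) y"] by (simp add: opnorm_scale norm_divide)
  then show ?thesis
    using assms by linarith
qed

text \<open>Every difference of two values in a cell is a combination of corner differences with
  weights at most 2/5 and 1/5; their sum is the contraction factor.\<close>

lemma opnorm_cell_diff:
  assumes "osc_le n a c"
  shows "opnorm n (cell (component a) (junction a) p q - cell (component a) (junction a) p q') \<le> 3 / 5 * c"
proof -
  let ?A = "component a" and ?X = "junction a"
  note osc = assms[unfolded osc_le_def, rule_format]
  have c: "0 \<le> c"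
    by (rule osc_le_nonneg[OF assms])
  have "?A p - ?X p = mscale (2 / 5) (?A p - ?A (p + 2)) + mscale (1 / 5) (?A p - ?A (p + 1))"
    by (simp add: fun_eq_iff junction_def harm_def mscale_def field_simps)
  then have 1: "opnorm n (?A p - ?X p) \<le> 3 / 5 * c"
    using opnorm_combination[OF osc osc] by simp
  have "?A p - ?X (p + 1) = mscale (2 / 5) (?A p - ?A (p + 1)) + mscale (1 / 5) (?A p - ?A (p + 2))"
    by (simp only: fun_eq_iff junction_def harm_def three_shift) (simp add: mscale_def field_simps)
  then have 2: "opnorm n (?A p - ?X (p + 1)) \<le> 3 / 5 * c"
    using opnorm_combination[OF osc osc] by simp
  \<comment> \<open>The shared corner \<open>p\<close> cancels; the zero term only brings the
    expression into the form of \<open>opnorm_combination\<close>.\<close>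
  have "?X p - ?X (p + 1) = mscale (2 / 5) 0 + mscale (1 / 5) (?A (p + 2) - ?A (p + 1))"
    by (simp only: fun_eq_iff junction_def harm_def three_shift) (simp add: mscale_def field_simps)
  then have 3: "opnorm n (?X p - ?X (p + 1)) \<le> 3 / 5 * c"
    using opnorm_combination[of n 0 c, OF _ osc] c by simp
  show ?thesis
    using 1 2 3 c unfolding cell_def by (auto simp: opnorm_minus_commute)
qed

lemma words_Suc_cases:
  assumes "u \<in> words (Suc n)"
  obtains u' p where "u = u' @ [p]" "u' \<in> words n"
proof -
  have "u \<noteq> []"
    using assms by (auto simp: words_def)
  then have "u = butlast u @ [last u]" by simp
  moreover have "butlast u \<in> words n"
    using assms by (simp add: words_def)
  ultimately show thesis by (rule that)
qed

text \<open>Lifts the estimate for one cell to all cells at once; it serves both the decay of the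
  oscillation and the distance from a matrix to its extension.\<close>

lemma opnorm_cell_block:
  assumes osc: "osc_le n a c"
    and diag: "\<And>u v p. u \<in> words n \<Longrightarrow> v \<in> words n \<Longrightarrow> y (u @ [p]) (v @ [p])
      = (cell (component a) (junction a) p q - cell (component a) (junction a) p q') u v"
    and off: "\<And>u v p p'. u \<in> words n \<Longrightarrow> v \<in> words n \<Longrightarrow> p \<noteq> p' \<Longrightarrow> y (u @ [p]) (v @ [p']) = 0"
  shows "opnorm (Suc n) y \<le> 3 / 5 * c"
proof (rule opnorm_block_diagonal_le)
  show "0 \<le> 3 / 5 * c"
    using osc_le_nonneg[OF osc] by simp
  show "opnorm n (component y p) \<le> 3 / 5 * c" for p
    using opnorm_cell_diff[OF osc, of p q q']
    by (subst opnorm_cong[of n _ "cell (component a) (junction a) p q - cell (component a) (junction a) p q'"])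
       (simp_all add: component_def[of y] diag)
qed (rule off)

lemma osc_le_harm_ext:
  assumes a: "a \<in> A_fin n" and osc: "osc_le n a c"
  shows "osc_le (Suc n) (harm_ext n a) (3 / 5 * c)"
  unfolding osc_le_def
proof (intro allI)
  fix q q'
  show "opnorm (Suc n) (component (harm_ext n a) q - component (harm_ext n a) q') \<le> 3 / 5 * c"
  proof (rule opnorm_cell_block[OF osc])
    fix u v p p' assume uv: "u \<in> words n" "v \<in> words n"
    show "(component (harm_ext n a) q - component (harm_ext n a) q') (u @ [p]) (v @ [p])
      = (cell (component a) (junction a) p q - cell (component a) (junction a) p q') u v"
      by (simp add: component_def[of "harm_ext n a"] harm_ext_entry[OF a uv] cell_apply)
    show "(component (harm_ext n a) q - component (harm_ext n a) q') (u @ [p]) (v @ [p']) = 0" if "p \<noteq> p'"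
      using that by (simp add: component_def[of "harm_ext n a"] harm_ext_entry[OF a uv])
  qed
qed

lemma emb_Suc_entry:
  "u \<in> words n \<Longrightarrow> v \<in> words n \<Longrightarrow> emb n (Suc n) x (u @ [p]) (v @ [q]) = (if p = q then x u v else 0)"
  by (auto simp: emb_append words_def ident_def)

lemma opnorm_harm_ext_diff:
  assumes a: "a \<in> A_fin n" and osc: "osc_le n a c"
  shows "opnorm (n + 2) (harm_ext n a - emb (n + 1) (n + 2) a) \<le> 3 / 5 * c"
proof -
  let ?y = "harm_ext n a - emb (Suc n) (Suc (Suc n)) a"
  have "opnorm (Suc (Suc n)) ?y \<le> 3 / 5 * c"
  proof (rule opnorm_block_diagonal_le)
    show "0 \<le> 3 / 5 * c"
      using osc_le_nonneg[OF osc] by simp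
    show "opnorm (Suc n) (component ?y q) \<le> 3 / 5 * c" for q
    \<comment> \<open>The embedded matrix takes the corner value, that of vertex 2, at all three
      vertices of a cell.\<close>
    proof (rule opnorm_cell_block[OF osc, where q = q and q' = 2])
      fix u v p p' assume uv: "u \<in> words n" "v \<in> words n"
      have e: "emb (Suc n) (Suc (Suc n)) a (u @ [p, q]) (v @ [p', q]) = a (u @ [p]) (v @ [p'])" for p'
        using emb_Suc_entry[of "u @ [p]" "Suc n" "v @ [p']" a q q] uv by (simp add: words_def)
      show "component ?y q (u @ [p]) (v @ [p])
        = (cell (component a) (junction a) p q - cell (component a) (junction a) p 2) u v"
        by (simp add: component_def[of ?y] harm_ext_entry[OF a uv] cell_apply e)
           (simp add: cell_def component_def)
      show "component ?y q (u @ [p]) (v @ [p']) = 0" if "p \<noteq> p'"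
        using that A_fin_diag[OF a, of "u @ [p]" "v @ [p']"] uv
        by (simp add: component_def[of ?y] harm_ext_entry[OF a uv] e words_def)
    qed
    fix u v q q' assume uv: "u \<in> words (Suc n)" "v \<in> words (Suc n)" and q: "q \<noteq> (q'::3)"
    obtain u' p where u: "u = u' @ [p]" "u' \<in> words n"
      using uv(1) by (rule words_Suc_cases)
    obtain v' p' where v: "v = v' @ [p']" "v' \<in> words n"
      using uv(2) by (rule words_Suc_cases)
    show "?y (u @ [q]) (v @ [q']) = 0"
      using q uv harm_ext_entry[OF a u(2) v(2), of p q p' q'] emb_Suc_entry[OF uv, of a q q']
      by (simp add: u(1) v(1))
  qed
  then show ?thesis by simp
qed

section \<open>Iterated harmonic extension and its limit\<close>

primrec harm_seq :: "nat \<Rightarrow> mat \<Rightarrow> nat \<Rightarrow> mat" where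
  "harm_seq n a 0 = a"
| "harm_seq n a (Suc k) = harm_ext (k + n) (harm_seq n a k)"

lemma A_fin_harm_seq: "a \<in> A_fin n \<Longrightarrow> harm_seq n a k \<in> A_fin (k + n)"
  by (induction k) (auto intro: A_fin_harm_ext)

lemma osc_le_harm_seq:
  assumes "a \<in> A_fin n" "osc_le n a c"
  shows "osc_le (k + n) (harm_seq n a k) ((3 / 5) ^ k * c)"
proof (induction k)
  case (Suc k)
  then show ?case
    using osc_le_harm_ext[OF A_fin_harm_seq[OF assms(1)] Suc] by (simp add: mult.assoc)
qed (use assms in simp)

lemma energy_harm_seq:
  assumes "a \<in> A_fin n"
  shows "energy (k + n) (harm_seq n a k) = (3 / 5) ^ k * energy n a"
  by (induction k) (simp_all add: energy_harm_ext[OF A_fin_harm_seq[OF assms]])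

lemma slice_slice: "k \<le> m \<Longrightarrow> m \<le> n \<Longrightarrow> slice k m (slice m n y) = slice k n y"
  unfolding slice_def by (simp flip: replicate_add)

lemma slice_harm_seq:
  assumes a: "a \<in> A_fin n" and "k \<le> l"
  shows "slice (k + n + 1) (l + n + 1) (harm_seq n a l) = harm_seq n a k"
  using assms(2)
proof (induction l rule: dec_induct)
  case base
  show ?case by (simp add: slice_def)
next
  case (step l)
  have "slice (k + n + 1) (Suc l + n + 1) (harm_seq n a (Suc l))
      = slice (k + n + 1) (l + n + 1) (slice (l + n + 1) (l + n + 2) (harm_ext (l + n) (harm_seq n a l)))"
    using step.hyps by (subst slice_slice) auto
  then show ?case
    unfolding slice_harm_ext[OF A_fin_harm_seq[OF a]] step.IH .
qed

text \<open>The steps of the iteration are bounded by a geometric series of ratio 3/5, whose sum 3/5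
  + (3/5)^2 + ... = 3/2 is the constant in the estimate.\<close>

lemma harmonic_limit:
  assumes a: "a \<in> A_fin n" and osc: "osc_le n a c"
  obtains g where "g \<in> energy_dom" "norm (g - iota (n + 1) a) \<le> 3 / 2 * c"
proof -
  define h where "h = harm_seq n a"
  have h: "h k \<in> A_fin (k + n)" for k
    unfolding h_def by (rule A_fin_harm_seq[OF a])
  have hM: "h k \<in> Mat (k + n + 1)" for k
    by (rule Mat_A_fin[OF h])
  define f where "f k = iota (k + n + 1) (h k)" for k
  have step: "norm (f (Suc k) - f k) \<le> 3 / 5 * c * (3 / 5) ^ k" for k
  proof -
    have emb: "emb (k + n + 1) (k + n + 2) (h k) \<in> Mat (k + n + 2)"
      by (rule Mat_emb[OF hM]) simp
    have "f (Suc k) - f k = iota (k + n + 2) (h (Suc k) - emb (k + n + 1) (k + n + 2) (h k))"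
      using iota_emb[OF hM, of k "k + n + 2"] iota_diff[OF _ emb] hM[of "Suc k"] by (simp add: f_def)
    then have "norm (f (Suc k) - f k) = opnorm (k + n + 2) (h (Suc k) - emb (k + n + 1) (k + n + 2) (h k))"
      using norm_iota[OF Mat_diff[OF _ emb]] hM[of "Suc k"] by simp
    also have "\<dots> \<le> 3 / 5 * ((3 / 5) ^ k * c)"
      using opnorm_harm_ext_diff[OF h[of k]] osc_le_harm_seq[OF a osc, of k] by (simp add: h_def)
    finally show ?thesis by (simp add: mult_ac)
  qed
  have geo: "(\<lambda>k. 3 / 5 * c * (3 / 5) ^ k) sums (3 / 5 * c * (1 / (1 - 3 / 5)))"
    by (intro sums_mult geometric_sums) simp
  have sm: "summable (\<lambda>k. f (Suc k) - f k)"
    by (rule summable_comparison_test'[OF sums_summable[OF geo]]) (rule step)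
  define g where "g = f 0 + (\<Sum>k. f (Suc k) - f k)"
  have "(\<lambda>k. f 0 + (\<Sum>i<k. f (Suc i) - f i)) \<longlonglongrightarrow> g"
    unfolding g_def by (intro tendsto_add tendsto_const summable_LIMSEQ sm)
  then have lim: "f \<longlonglongrightarrow> g"
    by (simp add: sum_lessThan_telescope)
  have "norm (g - f 0) \<le> 3 / 2 * c"
    using norm_suminf_le[OF step sums_summable[OF geo]] sums_unique[OF geo] by (simp add: g_def)
  moreover have "g \<in> energy_dom"
  proof (rule energy_domI)
    \<comment> \<open>\<open>A_inf\<close> asks for a sequence starting at level 0; zeros fill the
      levels below \<open>n\<close>.\<close>
    define a' where "a' m = (if m < n then 0 else h (m - n))" for m
    have "a' m \<in> A_fin m" for m
      using h[of "m - n"] mat.subspace_0[OF subspace_A_fin] by (cases "m < n") (simp_all add: a'_def)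
    moreover have "(\<lambda>m. iota (m + 1) (a' m)) \<longlonglongrightarrow> g"
      by (rule LIMSEQ_offset[of _ n]) (use lim in \<open>simp add: a'_def f_def[abs_def]\<close>)
    ultimately show "g \<in> A_inf"
      unfolding A_inf_def by blast
    \<comment> \<open>Each later iterate slices back to \<open>h k\<close>, so the sequence under
      the limit is eventually constant.\<close>
    have rho: "rho (k + n) g = h k" for k
    proof (intro ext)
      fix u v
      have "rho (k + n) (f l) u v = h k u v" if "k \<le> l" for l
        using rho_iota[OF hM[of l], of "k + n"] slice_harm_seq[OF a that] that by (simp add: f_def h_def)
      then have "(\<lambda>l. rho (k + n) (f l) u v) \<longlonglongrightarrow> h k u v"
        by (intro tendsto_eventually eventually_sequentiallyI[of k])
      then show "rho (k + n) g u v = h k u v"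
        using rho_tendsto[OF lim] LIMSEQ_unique by blast
    qed
    show "scaled_energy g m \<le> (5 / 3) ^ n * energy n a" for m
    proof -
      \<comment> \<open>Moving up by \<open>n\<close> levels reaches the range where
        \<open>rho\<close> of \<open>g\<close> is known, and covers the levels below
        \<open>n\<close> too.\<close>
      have "scaled_energy g m \<le> scaled_energy g (m + n)"
        using incseq_scaled_energy[OF \<open>g \<in> A_inf\<close>] by (simp add: incseq_def)
      also have "\<dots> = ((5 / 3) ^ m * (3 / 5) ^ m) * ((5 / 3) ^ n * energy n a)"
        unfolding scaled_energy_def rho unfolding h_def energy_harm_seq[OF a] by (simp add: power_add)
      also have "(5 / 3 :: real) ^ m * (3 / 5) ^ m = 1"
        by (simp flip: power_mult_distrib)
      finally show ?thesis by simp
    qed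
  qed
  ultimately show thesis
    using that[of g] by (simp add: f_def h_def)
qed

text \<open>The oscillation over the last letter vanishes on \<open>a \<otimes> I\<close>, and every approximating sequence
  is eventually close to such matrices.\<close>

lemma osc_le_near_emb:
  assumes "opnorm (n + 2) (a - emb (n + 1) (n + 2) x) \<le> c"
  shows "osc_le (n + 1) a (2 * c)"
  unfolding osc_le_def
proof (intro allI)
  fix i j
  let ?y = "a - emb (n + 1) (n + 2) x"
  \<comment> \<open>All components of the embedded matrix equal \<open>x\<close> and cancel in the
    difference.\<close>
  have "opnorm (n + 1) (component a i - component a j) = opnorm (n + 1) (component ?y i - component ?y j)"
  proof (rule opnorm_cong)
    fix u v assume "u \<in> words (n + 1)" "v \<in> words (n + 1)"
    then show "(component a i - component a j) u v = (component ?y i - component ?y j) u v"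
      using emb_Suc_entry[of u "n + 1" v x] by (simp add: component_def)
  qed
  also have "\<dots> \<le> opnorm (n + 1) (component ?y i) + opnorm (n + 1) (component ?y j)"
    using opnorm_triangle[of "n + 1" "component ?y i" "- component ?y j"] by simp
  also have "\<dots> \<le> 2 * c"
    using assms opnorm_component[of "n + 1" ?y i] opnorm_component[of "n + 1" ?y j] by simp
  finally show "opnorm (n + 1) (component a i - component a j) \<le> 2 * c" .
qed

text \<open>Two consecutive approximants are within 2/7 of \<open>e\<close>, so the oscillation is
  at most 4/7 and the harmonic limit is within 6/7; the remaining 1/7 is the distance of the
  approximant from \<open>b\<close>.\<close>

lemma energy_dom_dense: "A_inf \<subseteq> closure energy_dom"
proof
  fix b assume "b \<in> A_inf"
  then obtain a where a: "\<And>n. a n \<in> A_fin n" "(\<lambda>n. iota (n + 1) (a n)) \<longlonglongrightarrow> b"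
    by (auto simp: A_inf_def)
  show "b \<in> closure energy_dom"
    unfolding closure_approachable
  proof (intro allI impI)
    fix e :: real assume "0 < e"
    then have "0 < e / 7" by simp
    from LIMSEQ_D[OF a(2) this] obtain N
      where N: "\<And>n. N \<le> n \<Longrightarrow> norm (iota (n + 1) (a n) - b) < e / 7" by blast
    have M: "a n \<in> Mat (n + 1)" for n
      by (rule Mat_A_fin[OF a(1)])
    have emb: "emb (N + 1) (N + 2) (a N) \<in> Mat (N + 2)"
      by (rule Mat_emb[OF M]) simp
    have "opnorm (N + 2) (a (N + 1) - emb (N + 1) (N + 2) (a N))
        = norm (iota (N + 2) (a (N + 1)) - iota (N + 1) (a N))"
      using norm_iota[OF Mat_diff[OF _ emb]] iota_diff[OF _ emb] iota_emb[OF M, of N "N + 2"] M[of "N + 1"]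
      by simp
    also have "\<dots> \<le> norm (iota (N + 2) (a (N + 1)) - b) + norm (iota (N + 1) (a N) - b)"
      using norm_triangle_ineq4[of "iota (N + 2) (a (N + 1)) - b" "iota (N + 1) (a N) - b"] by simp
    also have "\<dots> \<le> 2 / 7 * e"
      using N[of N] N[of "N + 1"] by simp
    finally have "osc_le (N + 1) (a (N + 1)) (2 * (2 / 7 * e))"
      by (rule osc_le_near_emb)
    from harmonic_limit[OF a(1) this] obtain g
      where g: "g \<in> energy_dom" "norm (g - iota (N + 2) (a (N + 1))) \<le> 3 / 2 * (2 * (2 / 7 * e))"
      by auto
    have "dist g b \<le> norm (g - iota (N + 2) (a (N + 1))) + norm (iota (N + 2) (a (N + 1)) - b)"
      using norm_triangle_ineq[of "g - iota (N + 2) (a (N + 1))" "iota (N + 2) (a (N + 1)) - b"]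
      by (simp add: dist_norm)
    also have "\<dots> < e"
      using g(2) N[of "N + 1"] by simp
    finally show "\<exists>g\<in>energy_dom. dist g b < e"
      using g(1) by blast
  qed
qed

theorem proposition4p4:
  shows "(\<forall>b\<in>A_inf.
        incseq (\<lambda>m. (5 / 3) ^ m * energy m (rho m b)) \<and>
        (\<lambda>m. ennreal ((5 / 3) ^ m * energy m (rho m b))) \<longlonglongrightarrow> energy_inf b) \<and>
      quadratic_form_on A_inf energy_inf \<and>
      A_inf \<subseteq> closure energy_dom \<and>
      complete_for_norm energy_dom form_norm"
  using incseq_scaled_energy energy_inf_tendsto quadratic_form_energy_inf energy_dom_dense
    complete_energy_dom
  unfolding scaled_energy_def[abs_def] by blast

end
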